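(* The inclusion of Thompson's group $F$ in Thompson's group $T$ is a quasi-isometric embedding: with $d_F$ the word metric on $F$ with respect to $\{x_0,x_1\}$ and $d_T$ the word metric on $T$ with respect to $\{x_0,x_1,c_1\}$ (and hence for any choice of finite generating sets of $F$ and $T$), there are constants $K>0$ and $C$ such that for all $w,z\in F$, $$\frac1K d_F(w,z)-C\le d_T(w,z)\le K d_F(w,z)+C .$$
   Context: Thompson's group $T$ is the group of orientation-preserving piecewise-linear homeomorphisms of $S^1=[0,1]/(0\sim 1)$ with finitely many breakpoints, all slopes powers of $2$, and dyadic breakpoints, mapping dyadic rationals to dyadic rationals. $F\subset T$ is the subgroup of elements that are such homeomorphisms of $[0,1]$ (fixing $0$). Product convention: $vu=v\circ u$. Generators: $x_0(t)=t/2$ on $[0,\frac12]$, $t-\frac14$ on $[\frac12,\frac34]$, $2t-1$ on $[\frac34,1]$; $x_1$ is the identity on $[0,\frac12]$ and $x_1(t)=\frac12+\frac12x_0(2t-1)$ on $[\frac12,1]$; $c_1(t)=\frac12t+\frac34$ on $[0,\frac12)$, $2t-1$ on $[\frac12,\frac34)$, $t-\frac14$ on $[\frac34,1]$. The set $\{x_0,x_1\}$ generates $F$ and $\{x_0,x_1,c_1\}$ generates $T$. *)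

theory Defs
  imports
    "HOL-Analysis.Analysis"
    "HOL-Algebra.Bij"
    "HOL-Algebra.Generated_Groups"
begin

text \<open>
  The circle \<open>[0,1]/(0 \<sim> 1)\<close> lives on the set of representatives \<open>{0..<1}\<close>.
  Its topology is the quotient topology for the projection \<open>frac\<close>, which sends \<open>1\<close> to \<open>0\<close>
  and fixes the other points of \<open>[0,1]\<close>.
\<close>

definition circle :: "real topology" where
  "circle = topology (\<lambda>U. U \<subseteq> {0..<1} \<and>
     openin (top_of_set {0..1}) {t \<in> {0..1}. frac t \<in> U})"

lemma openin_circle:
  "openin circle U \<longleftrightarrow> U \<subseteq> {0..<1} \<and>
     openin (top_of_set {0..1}) {t \<in> {0..1}. frac t \<in> U}"
proof -
  let ?P = "\<lambda>U. {t \<in> {0..1::real}. frac t \<in> U}"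
  have "istopology (\<lambda>U. U \<subseteq> {0..<1} \<and> openin (top_of_set {0..1}) (?P U))"
    unfolding istopology_def
  proof (intro conjI allI impI)
    fix S T :: "real set"
    assume S: "S \<subseteq> {0..<1} \<and> openin (top_of_set {0..1}) (?P S)"
      and T: "T \<subseteq> {0..<1} \<and> openin (top_of_set {0..1}) (?P T)"
    show "S \<inter> T \<subseteq> {0..<1}" using S by blast
    have "?P (S \<inter> T) = ?P S \<inter> ?P T" by blast
    then show "openin (top_of_set {0..1}) (?P (S \<inter> T))" using S T by (simp add: openin_Int)
  next
    fix \<K> :: "real set set"
    assume K: "\<forall>U\<in>\<K>. U \<subseteq> {0..<1} \<and> openin (top_of_set {0..1}) (?P U)"
    show "\<Union>\<K> \<subseteq> {0..<1}" using K by blast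
    have "?P (\<Union>\<K>) = (\<Union>U\<in>\<K>. ?P U)" by blast
    moreover have "openin (top_of_set {0..1}) (\<Union>U\<in>\<K>. ?P U)"
      using K by (intro openin_Union) blast
    ultimately show "openin (top_of_set {0..1}) (?P (\<Union>\<K>))" by simp
  qed
  then show ?thesis by (simp add: circle_def)
qed

lemma topspace_circle: "topspace circle = {0..<1}"
proof
  show "topspace circle \<subseteq> {0..<1}"
    using openin_topspace[of circle] unfolding openin_circle by blast
  have "{t \<in> {0..1}. frac t \<in> {0..<1}} = {0..1::real}"
    by (auto simp: frac_lt_1)
  then have "openin circle {0..<1}" by (simp add: openin_circle)
  then show "{0..<1} \<subseteq> topspace circle" by (rule openin_subset)
qed

definition circle_lift :: "(real \<Rightarrow> real) \<Rightarrow> (real \<Rightarrow> real) \<Rightarrow> bool" where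
  "circle_lift f g \<longleftrightarrow> continuous_on UNIV g \<and> (\<forall>t. frac (g t) = f (frac t))"

text \<open>
  The library's \<^const>\<open>dyadics\<close> has only the non-negative dyadic rationals; below it is used for
  points of \<open>[0,1]\<close> only.

  \<open>B\<close> may contain points at which the slope does not change; \<open>0\<close> and \<open>1\<close> are always put in
  so that consecutive points of \<open>B\<close> cut \<open>[0,1]\<close> into the intervals of linearity.
\<close>

definition dyadic_piecewise_linear :: "(real \<Rightarrow> real) \<Rightarrow> bool" where
  "dyadic_piecewise_linear g \<longleftrightarrow>
     (\<exists>B. finite B \<and> {0, 1} \<subseteq> B \<and> B \<subseteq> dyadics \<inter> {0..1} \<and>
       (\<forall>a\<in>B. \<forall>b\<in>B. a < b \<and> {a<..<b} \<inter> B = {} \<longrightarrow>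
         (\<exists>(k::int) c. \<forall>t\<in>{a..b}. g t = 2 powi k * t + c)))"

text \<open>
  A homeomorphism of the circle preserves orientation if it has an increasing lift to the real
  line. Its lifts differ by integer constants, so breakpoints and slopes can be read off any lift.
\<close>

definition thompson_T_set :: "(real \<Rightarrow> real) set" where
  "thompson_T_set = {f \<in> extensional {0..<1}.
     homeomorphic_map circle circle f \<and>
     (\<exists>g. circle_lift f g \<and> strict_mono g \<and> dyadic_piecewise_linear g) \<and>
     f ` (dyadics \<inter> {0..<1}) \<subseteq> dyadics}"

text \<open>The product of \<^const>\<open>BijGroup\<close> is composition, \<open>v \<otimes> u = v \<circ> u\<close>.\<close>

definition thompson_T :: "(real \<Rightarrow> real) monoid" where
  "thompson_T = BijGroup {0..<1} \<lparr>carrier := thompson_T_set\<rparr>"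

definition thompson_F :: "(real \<Rightarrow> real) monoid" where
  "thompson_F = BijGroup {0..<1} \<lparr>carrier := {f \<in> thompson_T_set. f 0 = 0}\<rparr>"

definition x0 :: "real \<Rightarrow> real" where
  "x0 = (\<lambda>t\<in>{0..<1}. if t \<le> 1/2 then t / 2 else if t \<le> 3/4 then t - 1/4 else 2 * t - 1)"

definition x1 :: "real \<Rightarrow> real" where
  "x1 = (\<lambda>t\<in>{0..<1}. if t \<le> 1/2 then t else 1/2 + 1/2 * x0 (2 * t - 1))"

definition c1 :: "real \<Rightarrow> real" where
  "c1 = (\<lambda>t\<in>{0..<1}. if t < 1/2 then t / 2 + 3/4 else if t < 3/4 then 2 * t - 1 else t - 1/4)"

text \<open>
  Length and metric are meant for a generating set \<open>S\<close> of \<open>G\<close>; the length of an element outside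
  the subgroup generated by \<open>S\<close> is an unspecified number. The metric is the left-invariant one.
\<close>

definition word_length :: "('a, 'b) monoid_scheme \<Rightarrow> 'a set \<Rightarrow> 'a \<Rightarrow> nat" where
  "word_length G S g = (LEAST n. \<exists>ws. length ws = n \<and>
     set ws \<subseteq> S \<union> m_inv G ` S \<and> foldr (mult G) ws (one G) = g)"

definition word_metric :: "('a, 'b) monoid_scheme \<Rightarrow> 'a set \<Rightarrow> 'a \<Rightarrow> 'a \<Rightarrow> real" where
  "word_metric G S g h = real (word_length G S (inv\<^bsub>G\<^esub> g \<otimes>\<^bsub>G\<^esub> h))"

definition quasi_isometric_embedding ::
    "'a set \<Rightarrow> ('a \<Rightarrow> 'a \<Rightarrow> real) \<Rightarrow> 'b set \<Rightarrow> ('b \<Rightarrow> 'b \<Rightarrow> real) \<Rightarrow> ('a \<Rightarrow> 'b) \<Rightarrow> bool" where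
  "quasi_isometric_embedding X dX Y dY f \<longleftrightarrow> f ` X \<subseteq> Y \<and>
     (\<exists>K C. K > 0 \<and> (\<forall>w\<in>X. \<forall>z\<in>X.
        1 / K * dX w z - C \<le> dY (f w) (f z) \<and> dY (f w) (f z) \<le> K * dX w z + C))"

definition finite_generating_set :: "('a, 'b) monoid_scheme \<Rightarrow> 'a set \<Rightarrow> bool" where
  "finite_generating_set G S \<longleftrightarrow> finite S \<and> S \<subseteq> carrier G \<and> generate G S = carrier G"

end

theory Submission
  imports Defs
begin

text \<open>
  An element of T acts by cutting the circle into standard dyadic intervals and mapping each of
  them affinely onto another one. Up to constants, the least number of intervals that
  suffices bounds the word length in T from below and, for elements of F, the word length in F from
  above.

  It is at most linear in the word length, for any finite set of letters in T, because it
  is subadditive under composition (\<open>pieces_compose\<close>, \<open>pieces_le_T_length\<close>): two dyadic subdivisions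
  with \<open>m\<close> and \<open>n\<close> intervals have a common refinement with at most \<open>m + n\<close> intervals.

  Conversely, an element of F with \<open>n\<close> pieces is a word of length at most \<open>6 * n\<close> in \<open>x0\<close> and \<open>x1\<close>
  (\<open>F_length_le_pieces\<close>). Such an element is a pair of binary trees with equally many leaves
  (\<open>tree_pair\<close>), and it suffices to take a tree to the comb with as many leaves by linearly
  many letters (\<open>comb_tree\<close>). The letters \<open>x0\<close> and \<open>x1\<close> act as tree rotations at the root and at its
  right child; walking down the right spine costs conjugation by \<open>x0\<close>, but the walk never turns back.

  For \<open>f\<close> in F with a word of length \<open>n\<close> in T, the two estimates together give a word for \<open>f\<close> in F
  of length linear in \<open>n\<close>. The opposite inequality is immediate, since words in F are
  words in T, and a change of finite generating sets costs a constant factor. The second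
  estimate shows on the way that \<open>x0\<close> and \<open>x1\<close> generate F.

  That F and T are groups, and that the given generators belong to them, is proved from the
  description of T by intervals and lifts (\<open>thompson_T_iff\<close>).
\<close>

section \<open>Word length in groups\<close>

text \<open>
  The least length in \<open>word_length\<close> has no useful value when there is no word at all.
  Membership in a ball says that a word exists and bounds its length at the same time, so the
  estimates are made with it.
\<close>

definition in_ball :: "('a, 'b) monoid_scheme \<Rightarrow> 'a set \<Rightarrow> nat \<Rightarrow> 'a \<Rightarrow> bool" where
  "in_ball G S n g \<longleftrightarrow> (\<exists>ws. length ws \<le> n \<and>
     set ws \<subseteq> S \<union> m_inv G ` S \<and> foldr (mult G) ws (one G) = g)"

lemma in_ball_mono: "in_ball G S m g \<Longrightarrow> m \<le> n \<Longrightarrow> in_ball G S n g"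
  unfolding in_ball_def using le_trans by blast

lemma word_length_le: "in_ball G S n g \<Longrightarrow> word_length G S g \<le> n"
proof -
  assume "in_ball G S n g"
  then obtain ws where "length ws \<le> n" "set ws \<subseteq> S \<union> m_inv G ` S" "foldr (mult G) ws (one G) = g"
    unfolding in_ball_def by blast
  then have "word_length G S g \<le> length ws"
    unfolding word_length_def by (intro Least_le exI[of _ ws]) simp
  with \<open>length ws \<le> n\<close> show ?thesis by simp
qed

lemma in_ball_word_length:
  assumes "in_ball G S n g"
  shows "in_ball G S (word_length G S g) g"
proof -
  let ?P = "\<lambda>n. \<exists>ws. length ws = n \<and> set ws \<subseteq> S \<union> m_inv G ` S \<and> foldr (mult G) ws (one G) = g"
  have "\<exists>n. ?P n"
    using assms unfolding in_ball_def by blast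
  then have "?P (LEAST n. ?P n)"
    by (rule LeastI_ex)
  then show ?thesis
    unfolding in_ball_def word_length_def using order_refl by metis
qed

context group
begin

lemma foldr_mult_closed: "set ws \<subseteq> carrier G \<Longrightarrow> foldr (\<otimes>) ws \<one> \<in> carrier G"
  by (induction ws) auto

lemma foldr_mult_append:
  "set xs \<subseteq> carrier G \<Longrightarrow> set ys \<subseteq> carrier G \<Longrightarrow>
    foldr (\<otimes>) (xs @ ys) \<one> = foldr (\<otimes>) xs \<one> \<otimes> foldr (\<otimes>) ys \<one>"
  by (induction xs) (auto simp: m_assoc foldr_mult_closed)

lemma letters_closed: "S \<subseteq> carrier G \<Longrightarrow> S \<union> m_inv G ` S \<subseteq> carrier G"
  by auto

lemma in_ball_closed: "S \<subseteq> carrier G \<Longrightarrow> in_ball G S n g \<Longrightarrow> g \<in> carrier G"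
  unfolding in_ball_def using foldr_mult_closed letters_closed by blast

lemma in_ball_one: "in_ball G S n \<one>"
  unfolding in_ball_def by (rule exI[of _ "[]"]) auto

lemma in_ball_gen: "S \<subseteq> carrier G \<Longrightarrow> x \<in> S \<Longrightarrow> in_ball G S 1 x"
  unfolding in_ball_def by (rule exI[of _ "[x]"]) auto

lemma in_ball_gen_inv: "S \<subseteq> carrier G \<Longrightarrow> x \<in> S \<Longrightarrow> in_ball G S 1 (inv x)"
  unfolding in_ball_def by (rule exI[of _ "[inv x]"]) auto

lemma in_ball_mult:
  assumes S: "S \<subseteq> carrier G" and "in_ball G S m g" "in_ball G S n h"
  shows "in_ball G S (m + n) (g \<otimes> h)"
proof -
  obtain xs ys where "length xs \<le> m" "set xs \<subseteq> S \<union> m_inv G ` S" "foldr (\<otimes>) xs \<one> = g"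
    and "length ys \<le> n" "set ys \<subseteq> S \<union> m_inv G ` S" "foldr (\<otimes>) ys \<one> = h"
    using assms unfolding in_ball_def by blast
  then show ?thesis
    unfolding in_ball_def
    using foldr_mult_append[of xs ys] letters_closed[OF S]
    by (intro exI[of _ "xs @ ys"]) auto
qed

lemma in_ball_inv:
  assumes S: "S \<subseteq> carrier G" and "in_ball G S n g"
  shows "in_ball G S n (inv g)"
proof -
  have "in_ball G S (length ws) (inv (foldr (\<otimes>) ws \<one>))"
    if "set ws \<subseteq> S \<union> m_inv G ` S" for ws
    using that
  proof (induction ws)
    case Nil
    then show ?case by (simp add: in_ball_one)
  next
    case (Cons w ws)
    have "in_ball G S 1 (inv w)"
      using Cons.prems S in_ball_gen[OF S] in_ball_gen_inv[OF S] by auto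
    moreover have "w \<in> carrier G" "foldr (\<otimes>) ws \<one> \<in> carrier G"
      using Cons.prems letters_closed[OF S] by (auto intro!: foldr_mult_closed)
    ultimately show ?case
      using in_ball_mult[OF S Cons.IH, of 1 "inv w"] Cons.prems by (simp add: inv_mult_group)
  qed
  then show ?thesis
    using assms(2) unfolding in_ball_def[of G S n g] by (metis in_ball_mono)
qed

lemma in_ball_generate:
  assumes S: "S \<subseteq> carrier G" and "g \<in> generate G S"
  shows "\<exists>n. in_ball G S n g"
  using assms(2)
  by induction (use in_ball_one in_ball_gen[OF S] in_ball_gen_inv[OF S] in_ball_mult[OF S] in blast)+

lemma generate_in_ball: 
  assumes "in_ball G S n g"
  shows "g \<in> generate G S"
proof -
  have "foldr (\<otimes>) ws \<one> \<in> generate G S" if "set ws \<subseteq> S \<union> m_inv G ` S" for ws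
    using that by (induction ws) (auto intro: generate.intros)
  then show ?thesis using assms unfolding in_ball_def by blast
qed

text \<open>Rewriting every letter of a word as a word in other letters costs a constant factor.\<close>

lemma in_ball_change_generators:
  assumes S': "S' \<subseteq> carrier G" and letters: "\<And>x. x \<in> S \<Longrightarrow> in_ball G S' K x"
    and "in_ball G S n g"
  shows "in_ball G S' (K * n) g"
proof -
  have "in_ball G S' (K * length ws) (foldr (\<otimes>) ws \<one>)"
    if "set ws \<subseteq> S \<union> m_inv G ` S" for ws
    using that
  proof (induction ws)
    case Nil
    then show ?case by (simp add: in_ball_one)
  next
    case (Cons w ws)
    have "in_ball G S' K w"
      using Cons.prems letters in_ball_inv[OF S'] by auto
    then show ?case
      using in_ball_mult[OF S' _ Cons.IH, of K w] Cons.prems by simp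
  qed
  then show ?thesis
    using assms(3) unfolding in_ball_def[of G S n g] by (metis in_ball_mono mult_le_mono2)
qed

lemma finite_in_ball_bound:
  assumes "finite A" "\<And>a. a \<in> A \<Longrightarrow> \<exists>n. in_ball G S n a"
  shows "\<exists>K. \<forall>a\<in>A. in_ball G S K a"
  using assms
proof induction
  case (insert x F)
  then obtain K where "\<forall>a\<in>F. in_ball G S K a" by auto
  moreover obtain n where "in_ball G S n x" using insert.prems[of x] by auto
  ultimately have "\<forall>a\<in>insert x F. in_ball G S (max K n) a"
    by (auto intro: in_ball_mono)
  then show ?case ..
qed simp

text \<open>
  A subgroup has the same products and inverses as the whole group, so a word may be read in
  either; this turns words for elements of F into words for elements of T.
\<close>

lemma in_ball_subgroup:
  assumes "subgroup H G" "S \<subseteq> H"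
  shows "in_ball (G\<lparr>carrier := H\<rparr>) S n g \<longleftrightarrow> in_ball G S n g"
proof -
  have "m_inv (G\<lparr>carrier := H\<rparr>) ` S = m_inv G ` S"
    using assms by (auto simp: subset_iff image_iff)
  then show ?thesis
    unfolding in_ball_def by simp
qed

end

section \<open>Dyadic intervals and binary words\<close>

abbreviation I01 :: "real set" where "I01 \<equiv> {0..<1}"

text \<open>
  A binary word \<open>u\<close> names the standard dyadic interval of the numbers whose binary expansion
  begins with \<open>u\<close>, and \<open>cyl u\<close> is the increasing affine bijection from \<open>[0,1)\<close> onto it.
  Concatenation of words is composition of these bijections, so inclusion of intervals is the
  prefix order and every statement about intervals becomes one about words.
\<close>

primrec cyl :: "bool list \<Rightarrow> real \<Rightarrow> real" where
  "cyl [] s = s"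
| "cyl (b # u) s = (of_bool b + cyl u s) / 2"

lemma cyl_append: "cyl (u @ v) s = cyl u (cyl v s)"
  by (induction u) auto

lemma cyl_in: "s \<in> I01 \<Longrightarrow> cyl u s \<in> I01"
  by (induction u) auto

lemma cyl_affine: "cyl u s = cyl u 0 + s / 2 ^ length u"
  by (induction u) (auto simp: field_simps)

lemma first_digit:
  assumes "t \<in> I01"
  obtains b s where "s \<in> I01" "t = (of_bool b + s) / 2"
proof (cases "t < 1/2")
  case True
  then show ?thesis using that[of "2 * t" False] assms by auto
next
  case False
  then show ?thesis using that[of "2 * t - 1" True] assms by auto
qed

lemma first_digit_unique:
  "s \<in> I01 \<Longrightarrow> t \<in> I01 \<Longrightarrow> (of_bool b + s) / 2 = (of_bool c + t) / 2 \<longleftrightarrow> b = c \<and> s = t"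
  by (cases b; cases c) auto

text \<open>
  Standard dyadic intervals are nested or disjoint. The second conjunct in each case says where
  the common point lies inside the smaller interval.
\<close>

lemma cyl_overlap:
  "s \<in> I01 \<Longrightarrow> t \<in> I01 \<Longrightarrow> cyl u s = cyl v t \<Longrightarrow>
    (\<exists>x. v = u @ x \<and> s = cyl x t) \<or> (\<exists>x. u = v @ x \<and> t = cyl x s)"
proof (induction u arbitrary: v)
  case (Cons b u)
  show ?case
  proof (cases v)
    case (Cons c v')
    then have "b = c" "cyl u s = cyl v' t"
      using Cons.prems first_digit_unique[OF cyl_in[of s u] cyl_in[of t v']] by auto
    then show ?thesis
      using Cons.IH[of v'] Cons.prems Cons by auto
  qed (use Cons.prems in auto)
qed auto

definition covers :: "bool list set \<Rightarrow> bool" where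
  "covers P \<longleftrightarrow> (\<forall>t\<in>I01. \<exists>u\<in>P. \<exists>s\<in>I01. t = cyl u s)"

datatype tree = Leaf | Node tree tree

primrec leaves :: "tree \<Rightarrow> bool list list" where
  "leaves Leaf = [[]]"
| "leaves (Node l r) = map (Cons False) (leaves l) @ map (Cons True) (leaves r)"

lemma covers_leaves: "covers (set (leaves t))"
proof (induction t)
  case (Node l r)
  show ?case
    unfolding covers_def
  proof
    fix t :: real
    assume "t \<in> I01"
    then obtain b s where s: "s \<in> I01" "t = (of_bool b + s) / 2"
      using first_digit by blast
    obtain u s' where "u \<in> set (leaves (if b then r else l))" "s' \<in> I01" "s = cyl u s'"
      using Node s by (cases b) (auto simp: covers_def simp del: atLeastLessThan_iff)
    moreover from this have "b # u \<in> set (leaves (Node l r))" by (cases b) auto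
    moreover have "t = cyl (b # u) s'" using s \<open>s = cyl u s'\<close> by simp
    ultimately show "\<exists>u\<in>set (leaves (Node l r)). \<exists>s\<in>I01. t = cyl u s" by blast
  qed
qed (auto simp: covers_def)

lemma leaves_disjoint:
  "u \<in> set (leaves t) \<Longrightarrow> v \<in> set (leaves t) \<Longrightarrow> r \<in> I01 \<Longrightarrow> s \<in> I01 \<Longrightarrow>
    cyl u r = cyl v s \<Longrightarrow> u = v"
proof (induction t arbitrary: u v)
  case (Node l r')
  have child: "\<exists>b w'. w = b # w' \<and> w' \<in> set (leaves (if b then r' else l))"
    if w: "w \<in> set (leaves (Node l r'))" for w
  proof -
    consider w' where "w = False # w'" "w' \<in> set (leaves l)"
      | w' where "w = True # w'" "w' \<in> set (leaves r')"
      using w by auto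
    then show ?thesis
      by cases (metis (full_types))+
  qed
  obtain b u' c v' where uv: "u = b # u'" "v = c # v'"
    "u' \<in> set (leaves (if b then r' else l))" "v' \<in> set (leaves (if c then r' else l))"
    using child[OF Node.prems(1)] child[OF Node.prems(2)] by blast
  then have "b = c" "cyl u' r = cyl v' s"
    using Node.prems first_digit_unique[OF cyl_in[of r u'] cyl_in[of s v']] by auto
  moreover from this have "u' = v'"
    using Node.IH[of u' v'] Node.prems(3,4) uv(3,4) by (cases b) simp_all
  ultimately show ?case
    using uv(1,2) by simp
qed auto

lemma leaves_sorted: "sorted_wrt (\<lambda>u v. cyl u 0 < cyl v 0) (leaves t)"
proof (induction t)
  case (Node l r)
  have "cyl u 0 < 1 + cyl v 0" for u v
    using cyl_in[of 0 u] cyl_in[of 0 v] by simp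
  with Node show ?case
    by (auto simp: sorted_wrt_append sorted_wrt_map)
qed auto

text \<open>
  Either the cover contains the whole interval, or it splits into a cover of the left half and a
  cover of the right half, both nonempty and hence both smaller. Overlaps in the cover do no harm:
  the recursion stops at the first interval of the cover that it meets, so it picks the maximal
  ones.
\<close>

lemma tree_of_cover:
  "finite P \<Longrightarrow> covers P \<Longrightarrow> \<exists>t. set (leaves t) \<subseteq> P \<and> length (leaves t) \<le> card P"
proof (induction "card P" arbitrary: P rule: less_induct)
  case less
  show ?case
  proof (cases "[] \<in> P")
    case True
    then have "card P > 0" using less.prems card_gt_0_iff by blast
    then show ?thesis using True by (intro exI[of _ Leaf]) auto
  next
    case False
    define H where "H b = {u. b # u \<in> P}" for b
    have inj: "inj_on (Cons b) A" for b :: bool and A by (auto simp: inj_on_def)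
    have P: "P = Cons False ` H False \<union> Cons True ` H True"
    proof (rule Set.set_eqI)
      fix u show "u \<in> P \<longleftrightarrow> u \<in> Cons False ` H False \<union> Cons True ` H True"
        using False by (cases u; cases "hd u") (auto simp: H_def)
    qed
    have fin: "finite (H b)" for b
      using finite_imageD[of "Cons b" "H b"] less.prems(1) inj
      by (auto simp: H_def intro!: finite_vimageI[of P "Cons b", unfolded vimage_def])
    have card: "card P = card (H False) + card (H True)"
      by (subst P, subst card_Un_disjoint) (auto simp: fin card_image[OF inj])
    have cov: "covers (H b)" for b
      unfolding covers_def
    proof
      fix s :: real assume s: "s \<in> I01"
      then have "(of_bool b + s) / 2 \<in> I01" by auto
      then obtain u r where u: "u \<in> P" "r \<in> I01" "(of_bool b + s) / 2 = cyl u r"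
        using less.prems(2) unfolding covers_def by blast
      then obtain c v where v: "u = c # v" using False by (cases u) auto
      have "b = c \<and> s = cyl v r"
        using u(3) v first_digit_unique[OF s cyl_in[OF u(2), of v]] by simp
      then show "\<exists>u\<in>H b. \<exists>r\<in>I01. s = cyl u r"
        using u v unfolding H_def by blast
    qed
    have "(0::real) \<in> I01" by simp
    then have "H b \<noteq> {}" for b
      using cov[of b] unfolding covers_def by blast
    then have pos: "card (H b) > 0" for b
      using fin by (simp add: card_gt_0_iff)
    have small: "card (H b) < card P" for b
      using card pos[of False] pos[of True] by (cases b) auto
    obtain l r where "set (leaves l) \<subseteq> H False" "length (leaves l) \<le> card (H False)"
      "set (leaves r) \<subseteq> H True" "length (leaves r) \<le> card (H True)"
      using less.hyps[OF small fin cov] by metis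
    then show ?thesis
      using card P by (intro exI[of _ "Node l r"]) auto
  qed
qed

section \<open>Maps that are affine on dyadic intervals\<close>

text \<open>
  Expressing affinity through \<open>cyl\<close> avoids slopes and constants: restriction to a smaller interval appends the same word on both sides.
\<close>

definition carries :: "(real \<Rightarrow> real) \<Rightarrow> bool list \<Rightarrow> bool list \<Rightarrow> bool" where
  "carries f u v \<longleftrightarrow> (\<forall>s\<in>I01. f (cyl u s) = cyl v s)"

lemma carries_append: "carries f u v \<Longrightarrow> carries f (u @ x) (v @ x)"
  using cyl_in unfolding carries_def cyl_append by blast

lemma carries_compose:
  "carries f u v \<Longrightarrow> carries g v w \<Longrightarrow> carries (compose I01 g f) u w"
  using cyl_in unfolding carries_def compose_def by (metis (no_types, lifting) restrict_apply')

lemma carries_inverse: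
  assumes "f \<in> Bij I01" "carries f u v"
  shows "carries (\<lambda>t\<in>I01. inv_into I01 f t) v u"
proof -
  have "inv_into I01 f (cyl v s) = cyl u s" if "s \<in> I01" for s
    using that assms cyl_in[OF that, of u] unfolding carries_def Bij_def bij_betw_def
    by (metis (no_types, lifting) IntD2 inv_into_f_f mem_Collect_eq)
  then show ?thesis
    using cyl_in unfolding carries_def by (metis (no_types, lifting) restrict_apply')
qed

text \<open>
  At most \<open>n\<close> intervals suffice to describe \<open>f\<close>; for an element of F this bounds the number of leaves of
  a tree diagram. Intervals that cover are easier to build than a subdivision, and they contain
  one by \<open>tree_of_cover\<close>.
\<close>

definition pieces :: "nat \<Rightarrow> (real \<Rightarrow> real) \<Rightarrow> bool" where
  "pieces n f \<longleftrightarrow>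
     (\<exists>P. finite P \<and> card P \<le> n \<and> covers P \<and> (\<forall>u\<in>P. \<exists>v. carries f u v))"

lemma pieces_mono: "pieces m f \<Longrightarrow> m \<le> n \<Longrightarrow> pieces n f"
  unfolding pieces_def by (meson le_trans)

text \<open>
  Two subdivisions with \<open>m\<close> and \<open>n\<close> intervals have a common refinement with at most \<open>m + n\<close>
  intervals, because an intersection of two standard dyadic intervals, if not empty, is one of the
  two. The subdivisions compared are the image under \<open>f\<close> of the one for \<open>f\<close> and the one for \<open>g\<close>;
  the refinement is pulled back by \<open>f\<close>: \<open>R1\<close> collects the intervals whose image is the smaller
  one, \<open>k ` R2\<close> the preimages of the smaller intervals of the other subdivision.
\<close>

lemma pieces_compose:
  assumes f: "f \<in> Bij I01" and "pieces m f" "pieces n g"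
  shows "pieces (m + n) (compose I01 g f)"
proof -
  obtain P \<phi> where P: "finite P" "card P \<le> m" "covers P" "\<And>u. u \<in> P \<Longrightarrow> carries f u (\<phi> u)"
    using \<open>pieces m f\<close> unfolding pieces_def by metis
  obtain Q \<psi> where Q: "finite Q" "card Q \<le> n" "covers Q" "\<And>v. v \<in> Q \<Longrightarrow> carries g v (\<psi> v)"
    using \<open>pieces n g\<close> unfolding pieces_def by metis
  define k where "k v = (SOME w. carries f w v)" for v
  have k: "carries f (k v) v" if "carries f w v" for v w
    unfolding k_def using that by (rule someI)
  define R1 where "R1 = {u \<in> P. \<exists>v\<in>Q. \<exists>x. \<phi> u = v @ x}"
  define R2 where "R2 = {v \<in> Q. \<exists>w. carries f w v}"
  have fin: "finite R1" "finite R2"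
    using P Q by (auto simp: R1_def R2_def)
  have "card (R1 \<union> k ` R2) \<le> card R1 + card R2"
    using card_Un_le[of R1 "k ` R2"] card_image_le[OF fin(2), of k] by linarith
  also have "\<dots> \<le> m + n"
  proof (rule add_mono)
    show "card R1 \<le> m"
      using P card_mono[of P R1] by (auto simp: R1_def)
    show "card R2 \<le> n"
      using Q card_mono[of Q R2] by (auto simp: R2_def)
  qed
  finally have card: "card (R1 \<union> k ` R2) \<le> m + n" .
  have "covers (R1 \<union> k ` R2)"
    unfolding covers_def
  proof
    fix t :: real assume t: "t \<in> I01"
    then obtain u s where u: "u \<in> P" "s \<in> I01" "t = cyl u s"
      using P(3) unfolding covers_def by blast
    then have ft: "f t = cyl (\<phi> u) s" using P(4) unfolding carries_def by blast
    obtain v r where v: "v \<in> Q" "r \<in> I01" "f t = cyl v r"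
      using Q(3) cyl_in[OF u(2), of "\<phi> u"] ft unfolding covers_def by metis
    consider (fine) x where "\<phi> u = v @ x" | (coarse) x where "v = \<phi> u @ x"
      using cyl_overlap[OF u(2) v(2)] ft v(3) by metis
    then show "\<exists>u\<in>R1 \<union> k ` R2. \<exists>s\<in>I01. t = cyl u s"
    proof cases
      case fine
      then have "u \<in> R1" using u v unfolding R1_def by blast
      then show ?thesis using u by blast
    next
      case coarse
      then have c: "carries f (u @ x) v" using carries_append P(4) u by blast
      then have "v \<in> R2" using v unfolding R2_def by blast
      \<comment> \<open>injectivity: whichever interval is chosen, it is the preimage of the one of \<open>v\<close>\<close>
      moreover have "f (cyl (k v) r) = f t"
        using k[OF c] v unfolding carries_def by auto
      then have "t = cyl (k v) r"
        using f t cyl_in[OF v(2), of "k v"] unfolding Bij_def bij_betw_def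
        by (metis (no_types, lifting) IntD2 inj_onD mem_Collect_eq)
      ultimately show ?thesis using v by blast
    qed
  qed
  moreover have "\<exists>w. carries (compose I01 g f) u w" if "u \<in> R1 \<union> k ` R2" for u
    using that
  proof
    assume "u \<in> R1"
    then obtain v x where "u \<in> P" "v \<in> Q" "\<phi> u = v @ x" unfolding R1_def by blast
    then show ?thesis
      using P(4)[of u] carries_append[OF Q(4), of v x] carries_compose by metis
  next
    assume "u \<in> k ` R2"
    then obtain v w where "v \<in> Q" "u = k v" "carries f w v" unfolding R2_def by blast
    then show ?thesis
      using k Q(4)[of v] carries_compose by metis
  qed
  ultimately show ?thesis
    using card fin unfolding pieces_def by (intro exI[of _ "R1 \<union> k ` R2"]) simp
qed

lemma covers_image:
  assumes "f \<in> Bij I01" "covers P" "\<And>u. u \<in> P \<Longrightarrow> carries f u (\<phi> u)"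
  shows "covers (\<phi> ` P)"
  unfolding covers_def
proof
  fix y :: real assume "y \<in> I01"
  moreover have "f ` I01 = I01"
    using assms(1) by (simp add: Bij_def bij_betw_def)
  ultimately obtain t where "t \<in> I01" "y = f t"
    by blast
  then obtain u s where "u \<in> P" "s \<in> I01" "t = cyl u s"
    using assms(2) unfolding covers_def by blast
  then show "\<exists>v\<in>\<phi> ` P. \<exists>s\<in>I01. y = cyl v s"
    using assms(3) \<open>y = f t\<close> unfolding carries_def by blast
qed

lemma pieces_inverse:
  assumes f: "f \<in> Bij I01" and "pieces n f"
  shows "pieces n (\<lambda>t\<in>I01. inv_into I01 f t)"
proof -
  obtain P \<phi> where P: "finite P" "card P \<le> n" "covers P" "\<And>u. u \<in> P \<Longrightarrow> carries f u (\<phi> u)"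
    using \<open>pieces n f\<close> unfolding pieces_def by metis
  have "card (\<phi> ` P) \<le> n"
    using card_image_le[OF P(1), of \<phi>] P(2) by linarith
  moreover have "\<forall>v\<in>\<phi> ` P. \<exists>u. carries (\<lambda>t\<in>I01. inv_into I01 f t) v u"
    using carries_inverse[OF f P(4)] by blast
  ultimately show ?thesis
    unfolding pieces_def using P(1) covers_image[OF f P(3,4)] by (intro exI[of _ "\<phi> ` P"]) simp
qed

text \<open>
  The tree diagram of an increasing map. The image of a subdivision by leaves of a tree is again a
  subdivision by dyadic intervals, hence given by the leaves of a tree; since the map increases,
  it matches the leaves in their order from left to right.
\<close>

lemma tree_pair:
  assumes f: "f \<in> Bij I01" and mono: "strict_mono_on I01 f" and "pieces n f"
  obtains t t' where "length (leaves t) \<le> n" "list_all2 (carries f) (leaves t) (leaves t')"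
proof -
  obtain P \<phi> where P: "finite P" "card P \<le> n" "covers P" "\<And>u. u \<in> P \<Longrightarrow> carries f u (\<phi> u)"
    using \<open>pieces n f\<close> unfolding pieces_def by metis
  obtain t where t: "set (leaves t) \<subseteq> P" "length (leaves t) \<le> card P"
    using tree_of_cover[OF P(1,3)] by blast
  have c: "carries f u (\<phi> u)" if "u \<in> set (leaves t)" for u
    using P(4) t(1) that by blast
  then have start: "cyl (\<phi> u) 0 = f (cyl u 0)" if "u \<in> set (leaves t)" for u
    using that unfolding carries_def by force
  have "covers (\<phi> ` set (leaves t))"
    using covers_image[OF f covers_leaves c] .
  then obtain t' where t': "set (leaves t') \<subseteq> \<phi> ` set (leaves t)"
    using tree_of_cover by (meson finite_imageI finite_set)
  have "\<phi> u \<in> set (leaves t')" if u: "u \<in> set (leaves t)" for u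
  proof -
    have zero: "(0::real) \<in> I01" by simp
    obtain w r where w: "w \<in> set (leaves t')" "r \<in> I01" "cyl (\<phi> u) 0 = cyl w r"
      using covers_leaves[of t'] cyl_in[OF zero, of "\<phi> u"] unfolding covers_def by blast
    then obtain u' where u': "u' \<in> set (leaves t)" "w = \<phi> u'" using t' by blast
    have "f (cyl u 0) = f (cyl u' r)"
      using start[OF u] w u' c[OF u'(1)] unfolding carries_def by auto
    then have "cyl u 0 = cyl u' r"
      using strict_mono_on_imp_inj_on[OF mono] cyl_in[OF zero, of u] cyl_in[OF w(2), of u']
      by (auto simp: inj_on_def)
    then have "u = u'"
      using leaves_disjoint[OF u u'(1) zero w(2)] by blast
    then show ?thesis using w u' by simp
  qed
  then have sets: "set (map \<phi> (leaves t)) = set (leaves t')"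
    using t' by auto
  let ?st = "\<lambda>u. cyl u 0"
  \<comment> \<open>two sorted lists with the same elements are equal, and starting points determine leaves\<close>
  have "sorted_wrt (\<lambda>u v. ?st (\<phi> u) < ?st (\<phi> v)) (leaves t)"
  proof (rule sorted_wrt_mono_rel[OF _ leaves_sorted])
    fix u v assume uv: "u \<in> set (leaves t)" "v \<in> set (leaves t)" "?st u < ?st v"
    then show "?st (\<phi> u) < ?st (\<phi> v)"
      using start mono cyl_in[of 0 u] cyl_in[of 0 v] by (auto simp: strict_mono_on_def)
  qed
  then have "sorted_wrt (<) (map ?st (map \<phi> (leaves t)))"
    by (simp add: sorted_wrt_map)
  moreover have "sorted_wrt (<) (map ?st (leaves t'))"
    using leaves_sorted by (simp add: sorted_wrt_map)
  moreover have "set (map ?st (map \<phi> (leaves t))) = set (map ?st (leaves t'))"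
    using sets by (metis list.set_map)
  ultimately have "map ?st (map \<phi> (leaves t)) = map ?st (leaves t')"
    by (metis strict_sorted_equal)
  moreover have "inj_on ?st (set (leaves t'))"
    using leaves_disjoint[of _ t' _ 0 0] by (auto simp: inj_on_def)
  ultimately have "map \<phi> (leaves t) = leaves t'"
    using sets by (intro map_inj_on[of ?st]) (simp_all only: Un_absorb)
  moreover have "list_all2 (carries f) (leaves t) (map \<phi> (leaves t))"
    unfolding list_all2_map2 list_all2_same using c by blast
  ultimately have "list_all2 (carries f) (leaves t) (leaves t')"
    by (simp only:)
  then show ?thesis
    using that t(2) P(2) le_trans by blast
qed

section \<open>Lifts and homeomorphisms of the circle\<close>

lemma frac_in_I01: "frac t \<in> I01"
  by (simp add: frac_lt_1)

text \<open>
  The circle is also the quotient of the whole line. A lift is a map of the line, so continuity on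
  the circle is easiest to test there.
\<close>

lemma openin_circle_iff: "openin circle U \<longleftrightarrow> U \<subseteq> I01 \<and> open (frac -` U)"
proof
  assume r: "U \<subseteq> I01 \<and> open (frac -` U)"
  have "{t \<in> {0..1}. frac t \<in> U} = {0..1} \<inter> frac -` U" by auto
  with r show "openin circle U"
    unfolding openin_circle by (simp add: openin_open_Int)
next
  assume "openin circle U"
  then obtain W where U: "U \<subseteq> I01" and W: "open W" "{t \<in> {0..1}. frac t \<in> U} = {0..1} \<inter> W"
    unfolding openin_circle openin_open by blast
  have WU: "frac t \<in> U" if "t \<in> W" "0 \<le> t" "t \<le> 1" for t
  proof -
    have "t \<in> {0..1} \<inter> W" using that by simp
    then show ?thesis unfolding W(2)[symmetric] by simp
  qed
  have UW: "t \<in> W" if "frac t \<in> U" "0 \<le> t" "t \<le> 1" for t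
  proof -
    have "t \<in> {t \<in> {0..1}. frac t \<in> U}" using that by simp
    then show ?thesis unfolding W(2) by simp
  qed
  have "\<exists>e>0. ball x e \<subseteq> frac -` U" if x: "frac x \<in> U" for x
  proof (cases "x \<in> \<int>")
    case False
    define n where "n = \<lfloor>x\<rfloor>"
    have "frac x \<in> W"
      using UW[of "frac x"] x frac_lt_1[of x] by simp
    moreover have "frac x > 0" using False by simp
    ultimately have "frac x \<in> W \<inter> {0<..<1}" using frac_lt_1[of x] by simp
    then obtain e where e: "e > 0" "ball (frac x) e \<subseteq> W \<inter> {0<..<1}"
      using W(1) by (meson open_Int open_contains_ball open_greaterThanLessThan)
    have "frac y \<in> U" if "dist x y < e" for y
    proof -
      have "y - of_int n \<in> ball (frac x) e"
        using that by (simp add: frac_def n_def dist_real_def)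
      then have "y - of_int n \<in> W \<inter> {0<..<1}" using e by blast
      then have "frac (y - of_int n) \<in> U" by (intro WU) simp_all
      then show ?thesis by (metis add_diff_cancel_left' diff_add_cancel frac_add_of_int_right)
    qed
    then show ?thesis using e(1) by (intro exI[of _ e]) auto
  next
    \<comment> \<open>near an integer the fractional part is near \<open>0\<close> on the right and near \<open>1\<close> on the left\<close>
    case True
    then obtain n where n: "x = of_int n" by (rule Ints_cases)
    then have "0 \<in> U" using x by simp
    then have "0 \<in> W" "1 \<in> W"
      using UW[of 0] UW[of 1] by (simp_all add: frac_def)
    then obtain d e where de: "d > 0" "ball 0 d \<subseteq> W" "e > 0" "ball 1 e \<subseteq> W"
      using W(1) by (meson open_contains_ball)
    define m where "m = min 1 (min d e)"
    have "frac y \<in> U" if "dist x y < m" for y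
    proof (cases "y \<ge> of_int n")
      case True
      then have "y - of_int n \<in> ball 0 d" "0 \<le> y - of_int n" "y - of_int n \<le> 1"
        using that n by (auto simp: m_def dist_real_def)
      then have "frac (y - of_int n) \<in> U" using WU de by blast
      then show ?thesis by (metis diff_add_cancel frac_add_of_int_right)
    next
      case False
      then have "y - of_int n + 1 \<in> ball 1 e" "0 \<le> y - of_int n + 1" "y - of_int n + 1 \<le> 1"
        using that n by (auto simp: m_def dist_real_def)
      then have "frac (y - of_int n + 1) \<in> U" using WU de by blast
      then show ?thesis by (metis diff_add_cancel frac_1_eq frac_add_of_int_right)
    qed
    then show ?thesis using de by (intro exI[of _ m]) (auto simp: m_def)
  qed
  then have "open (frac -` U)"
    unfolding open_contains_ball by auto
  with U show "U \<subseteq> I01 \<and> open (frac -` U)" by blast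
qed

lemma continuous_map_of_lift:
  assumes "f \<in> I01 \<rightarrow> I01" "circle_lift f g"
  shows "continuous_map circle circle f"
  unfolding continuous_map_def topspace_circle
proof (intro conjI allI impI)
  fix U assume U: "openin circle U"
  have "frac -` {x \<in> I01. f x \<in> U} = g -` (frac -` U)"
    using assms(2) frac_in_I01 unfolding circle_lift_def by auto
  moreover have "open (g -` (frac -` U))"
    using assms(2) U open_vimage unfolding circle_lift_def openin_circle_iff by blast
  ultimately show "openin circle {x \<in> I01. f x \<in> U}"
    unfolding openin_circle_iff by auto
qed (use assms in auto)

text \<open>
  The numbers \<open>g t\<close> and \<open>g (t + 1)\<close> have the same fractional part, so an increasing lift gains at
  least \<open>1\<close> over each unit interval and is unbounded in both directions.
\<close>

lemma lift_surj:
  assumes "circle_lift f g" "strict_mono g"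
  shows "surj g"
proof -
  have step: "g t + 1 \<le> g (t + 1)" for t
  proof -
    have "frac (g (t + 1)) = frac (g t)"
      using assms(1) unfolding circle_lift_def by (simp add: frac_1_eq)
    then obtain n where n: "g (t + 1) = g t + of_int n"
      by (metis frac_eqE add.commute)
    moreover have "g t < g (t + 1)" using assms(2) by (simp add: strict_mono_def)
    ultimately have "n \<ge> 1" by linarith
    with n show ?thesis by simp
  qed
  have up: "g 0 + real n \<le> g (real n)" for n
  proof (induction n)
    case (Suc n)
    then show ?case using step[of "real n"] by (simp add: add.commute)
  qed simp
  have down: "g (- real n) \<le> g 0 - real n" for n
  proof (induction n)
    case (Suc n)
    then show ?case using step[of "- real (Suc n)"] by simp
  qed simp
  have "\<exists>x. g x = y" for y
  proof -
    obtain n where n: "\<bar>y - g 0\<bar> \<le> real n" using real_arch_simple by blast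
    then have "g (- real n) \<le> y" "y \<le> g (real n)" using up[of n] down[of n] by linarith+
    moreover have "continuous_on {- real n..real n} g"
      using assms(1) continuous_on_subset unfolding circle_lift_def by blast
    ultimately show ?thesis
      using IVT'[of g "- real n" y "real n"] by auto
  qed
  then show ?thesis by (metis surjI)
qed

lemma continuous_of_strict_mono_surj:
  fixes g :: "real \<Rightarrow> real"
  assumes "strict_mono g" "surj g"
  shows "continuous_on UNIV g"
  using assms by (intro continuous_onI_mono) (auto simp: strict_mono_less_eq)

text \<open>
  A strictly increasing map of the line onto itself is continuous, so the inverse of a lift has the
  continuity that a lift needs.
\<close>

lemma inverse_lift:
  assumes f: "f \<in> Bij I01" and g: "circle_lift f g" "strict_mono g"
  shows "circle_lift (\<lambda>t\<in>I01. inv_into I01 f t) (inv_into UNIV g)" "strict_mono (inv_into UNIV g)"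
proof -
  have surj: "surj g" using lift_surj[OF g] .
  have inj: "inj g" using g(2) by (rule strict_mono_imp_inj_on)
  show mono: "strict_mono (inv_into UNIV g)"
  proof (rule strict_monoI)
    fix x y :: real assume "x < y"
    then have "g (inv_into UNIV g x) < g (inv_into UNIV g y)"
      using surj by (simp add: surj_f_inv_f)
    then show "inv_into UNIV g x < inv_into UNIV g y"
      by (simp add: strict_mono_less[OF g(2)])
  qed
  have "frac (inv_into UNIV g y) = inv_into I01 f (frac y)" for y
  proof -
    have "f (frac (inv_into UNIV g y)) = frac y"
      using g(1) surj unfolding circle_lift_def by (metis surj_f_inv_f)
    then show ?thesis
      using f frac_in_I01[of "inv_into UNIV g y"] unfolding Bij_def bij_betw_def
      by (metis (no_types, lifting) IntD2 inv_into_f_f mem_Collect_eq)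
  qed
  moreover have "continuous_on UNIV (inv_into UNIV g)"
    using mono inj_imp_surj_inv[OF inj] by (rule continuous_of_strict_mono_surj)
  ultimately show "circle_lift (\<lambda>t\<in>I01. inv_into I01 f t) (inv_into UNIV g)"
    unfolding circle_lift_def using frac_in_I01 by auto
qed

lemma homeomorphic_map_of_lift:
  assumes f: "f \<in> Bij I01" and g: "circle_lift f g" "strict_mono g"
  shows "homeomorphic_map circle circle f"
proof -
  let ?h = "\<lambda>t\<in>I01. inv_into I01 f t"
  have h: "?h \<in> Bij I01" using restrict_inv_into_Bij[OF f] .
  have "homeomorphic_maps circle circle f ?h"
    unfolding homeomorphic_maps_def topspace_circle
  proof (intro conjI ballI)
    show "continuous_map circle circle f"
      using continuous_map_of_lift[OF Bij_imp_funcset[OF f] g(1)] .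
    show "continuous_map circle circle ?h"
      using continuous_map_of_lift[OF Bij_imp_funcset[OF h] inverse_lift(1)[OF f g]] .
    show "?h (f x) = x" if "x \<in> I01" for x
      using that f Bij_imp_funcset[OF f] by (auto simp: Bij_def bij_betw_def inv_into_f_f)
    show "f (?h y) = y" if "y \<in> I01" for y
      using that f by (auto simp: Bij_def bij_betw_def intro!: f_inv_into_f)
  qed
  then show ?thesis using homeomorphic_map_maps by blast
qed

section \<open>Thompson's group in terms of dyadic intervals\<close>

text \<open>
  Unlike \<open>dyadics\<close>, this contains negative numbers: the constants of the affine pieces of a lift
  and the lift itself may be negative.
\<close>

definition dyadic :: "real \<Rightarrow> bool" where
  "dyadic x \<longleftrightarrow> (\<exists>n. 2 ^ n * x \<in> \<int>)"

lemma dyadic_eventually: "dyadic x \<Longrightarrow> eventually (\<lambda>n. 2 ^ n * x \<in> \<int>) sequentially"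
proof -
  assume "dyadic x"
  then obtain m where m: "2 ^ m * x \<in> \<int>" unfolding dyadic_def by blast
  have "2 ^ n * x \<in> \<int>" if "n \<ge> m" for n
  proof -
    have "2 ^ n * x = 2 ^ (n - m) * (2 ^ m * x)"
      using that by (metis (no_types) le_add_diff_inverse2 mult.assoc power_add)
    also have "\<dots> \<in> \<int>" using m by (intro Ints_mult[OF _ m] Ints_power) auto
    finally show ?thesis .
  qed
  then show ?thesis unfolding eventually_sequentially by blast
qed

lemma dyadic_diff: "dyadic x \<Longrightarrow> dyadic y \<Longrightarrow> dyadic (x - y)"
proof -
  assume "dyadic x" "dyadic y"
  then have "eventually (\<lambda>n. 2 ^ n * x \<in> \<int> \<and> 2 ^ n * y \<in> \<int>) sequentially"
    by (intro eventually_conj dyadic_eventually)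
  then obtain n where "2 ^ n * x \<in> \<int>" "2 ^ n * y \<in> \<int>"
    by (metis (no_types, lifting) eventually_sequentially order_refl)
  then have "2 ^ n * (x - y) \<in> \<int>" by (simp add: right_diff_distrib)
  then show ?thesis unfolding dyadic_def by blast
qed

lemma dyadic_Ints: "x \<in> \<int> \<Longrightarrow> dyadic x"
  unfolding dyadic_def by (intro exI[of _ 0]) simp

lemma dyadic_add: "dyadic x \<Longrightarrow> dyadic y \<Longrightarrow> dyadic (x + y)"
  using dyadic_diff[of x "0 - y"] dyadic_diff[of 0 y] dyadic_Ints[of 0] by simp

lemma dyadic_half_power: "dyadic x \<Longrightarrow> dyadic (x / 2 ^ m)"
proof -
  assume "dyadic x"
  then obtain n where "2 ^ n * x \<in> \<int>" unfolding dyadic_def by blast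
  then have "2 ^ (n + m) * (x / 2 ^ m) \<in> \<int>" by (simp add: power_add)
  then show ?thesis unfolding dyadic_def by blast
qed

lemma dyadic_power: "dyadic x \<Longrightarrow> dyadic (2 ^ m * x)"
proof -
  assume "dyadic x"
  then obtain n where n: "2 ^ n * x \<in> \<int>" unfolding dyadic_def by blast
  then have "2 ^ m * (2 ^ n * x) \<in> \<int>" by (intro Ints_mult[OF _ n] Ints_power) auto
  then have "2 ^ n * (2 ^ m * x) \<in> \<int>" by (simp add: mult.left_commute)
  then show ?thesis unfolding dyadic_def by blast
qed

lemma dyadic_powi: "dyadic x \<Longrightarrow> dyadic (2 powi k * x)"
  using dyadic_power[of x "nat k"] dyadic_half_power[of x "nat (- k)"]
  by (cases "k \<ge> 0") (auto simp: power_int_def field_simps)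

lemma dyadics_iff_dyadic: "x \<in> dyadics \<longleftrightarrow> 0 \<le> x \<and> dyadic x" for x :: real
proof
  assume "x \<in> dyadics"
  then obtain m k where "x = of_nat m / 2 ^ k" unfolding dyadics_def by blast
  then show "0 \<le> x \<and> dyadic x" using dyadic_half_power[of "of_nat m" k] dyadic_Ints by simp
next
  assume x: "0 \<le> x \<and> dyadic x"
  then obtain k i where "2 ^ k * x = of_int i" unfolding dyadic_def Ints_def by blast
  moreover from this x have "i \<ge> 0"
    by (metis mult_nonneg_nonneg of_int_0_le_iff zero_le_numeral zero_le_power)
  ultimately have "x = of_nat (nat i) / 2 ^ k" by (simp add: field_simps)
  then show "x \<in> dyadics" unfolding dyadics_def by blast
qed

lemma dyadic_cyl: "dyadic (cyl u s) \<longleftrightarrow> dyadic s"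
proof -
  have *: "dyadic (cyl u 0)"
  proof (induction u)
    case (Cons b u)
    then show ?case using dyadic_half_power[of "of_bool b + cyl u 0" 1] dyadic_add dyadic_Ints by auto
  qed (simp add: dyadic_Ints)
  have "s = 2 ^ length u * (cyl u s - cyl u 0)"
    using cyl_affine[of u s] by simp
  then show ?thesis
    using * cyl_affine[of u s] dyadic_add dyadic_diff dyadic_power dyadic_half_power by metis
qed

lemma cyl_grid: "\<exists>i::int. 0 \<le> i \<and> i < 2 ^ length u \<and> (\<forall>s. cyl u s = (of_int i + s) / 2 ^ length u)"
proof (induction u)
  case (Cons b u)
  then obtain i :: int where "0 \<le> i" "i < 2 ^ length u" "\<forall>s. cyl u s = (of_int i + s) / 2 ^ length u"
    by blast
  then show ?case
    by (intro exI[of _ "of_bool b * 2 ^ length u + i"]) (auto simp: field_simps)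
qed auto

lemma covers_length: "covers {u. length u = n}"
proof (induction n)
  case (Suc n)
  show ?case
    unfolding covers_def
  proof
    fix t :: real assume "t \<in> I01"
    then obtain b s where s: "s \<in> I01" "t = (of_bool b + s) / 2"
      using first_digit by blast
    then obtain u r where "length u = n" "r \<in> I01" "s = cyl u r"
      using Suc unfolding covers_def by blast
    then show "\<exists>u\<in>{u. length u = Suc n}. \<exists>r\<in>I01. t = cyl u r"
      using s by (intro bexI[of _ "b # u"] bexI[of _ r]) auto
  qed
qed (auto simp: covers_def)

text \<open>
  Modulo \<open>1\<close>, an interval of length \<open>1 / 2 ^ m\<close> that starts at a multiple of its length is a standard
  dyadic interval.
\<close>

lemma frac_grid_cell: "\<exists>v. \<forall>s\<in>I01. frac ((of_int j + s) / 2 ^ m) = cyl v s"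
proof (induction m)
  case 0
  then show ?case by (intro exI[of _ "[]"]) auto
next
  case (Suc m)
  then obtain v where v: "\<And>s. s \<in> I01 \<Longrightarrow> frac ((of_int j + s) / 2 ^ m) = cyl v s" by blast
  define q where "q = j div 2 ^ m"
  have "frac ((of_int j + s) / 2 ^ Suc m) = cyl (odd q # v) s" if s: "s \<in> I01" for s
  proof -
    define x where "x = (of_int j + s) / 2 ^ m"
    have "\<lfloor>of_int j + s\<rfloor> = j" using s by (intro floor_unique) auto
    then have "\<lfloor>x\<rfloor> = q"
      using floor_divide_real_eq_div[of "2 ^ m" "of_int j + s"] unfolding x_def q_def by simp
    then have "x = of_int q + cyl v s"
      using v[OF s] unfolding x_def[symmetric] frac_def by simp
    then have "x / 2 - (of_bool (odd q) + cyl v s) / 2 = of_int (q div 2)"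
      by (cases "odd q") (auto elim!: evenE oddE simp: field_simps)
    moreover have "(of_bool (odd q) + cyl v s) / 2 \<in> I01"
      using cyl_in[OF s, of "odd q # v"] by simp
    ultimately have "frac (x / 2) = (of_bool (odd q) + cyl v s) / 2"
      unfolding frac_unique_iff by simp
    then show ?thesis by (simp add: x_def field_simps)
  qed
  then show ?case by blast
qed

text \<open>
  On each interval of linearity the lift is \<open>2 powi k * t + c\<close> with \<open>c\<close> dyadic, because the lift has
  dyadic values at the breakpoints. For all large \<open>n\<close>, the subdivision into \<open>2 ^ n\<close> equal intervals
  then refines the given one, and the image of each small interval starts at a multiple of its
  length, so it is standard modulo \<open>1\<close>. As there are finitely many breakpoints, one \<open>n\<close> serves all.
\<close>

lemma pieces_of_piecewise_linear:
  assumes lift: "circle_lift f g" and "dyadic_piecewise_linear g"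
    and dy: "f ` (dyadics \<inter> I01) \<subseteq> dyadics"
  shows "\<exists>n. pieces n f"
proof -
  obtain B where B: "finite B" "{0, 1} \<subseteq> B" "B \<subseteq> dyadics \<inter> {0..1}"
    and lin: "\<forall>a\<in>B. \<forall>b\<in>B. a < b \<and> {a<..<b} \<inter> B = {} \<longrightarrow>
         (\<exists>(k::int) c. \<forall>t\<in>{a..b}. g t = 2 powi k * t + c)"
    using assms(2) unfolding dyadic_piecewise_linear_def by blast
  define adj where "adj a b \<longleftrightarrow> a < b \<and> {a<..<b} \<inter> B = {}" for a b
  have Bdy: "dyadic b" if "b \<in> B" for b
    using B(3) that dyadics_iff_dyadic by blast
  have "eventually (\<lambda>n. adj a b \<longrightarrow> (\<exists>k c. k \<le> int n \<and> 2 ^ n * (2 powi (- k) * c) \<in> \<int> \<and>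
      (\<forall>t\<in>{a..b}. g t = 2 powi k * t + c))) sequentially" if ab: "a \<in> B" "b \<in> B" for a b
  proof (cases "adj a b")
    case True
    then obtain k c where kc: "\<forall>t\<in>{a..b}. g t = 2 powi k * t + c"
      using lin ab unfolding adj_def by metis
    have "a \<in> dyadics" "a \<in> {0..1}" "b \<in> {0..1}" using B(3) ab by blast+
    then have a: "a \<in> dyadics \<inter> I01" using True unfolding adj_def by simp
    then have "f a \<in> dyadics" using dy by blast
    then have "dyadic (f (frac a))" using a by (simp add: dyadics_iff_dyadic)
    then have "dyadic (frac (g a))" using lift unfolding circle_lift_def by simp
    then have "dyadic (frac (g a) + of_int \<lfloor>g a\<rfloor>)"
      by (intro dyadic_add) (auto intro: dyadic_Ints)
    then have "dyadic (g a)" by (simp add: frac_def)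
    then have "dyadic (g a - 2 powi k * a)"
      using dyadic_diff dyadic_powi Bdy ab by blast
    then have "dyadic (2 powi (- k) * c)"
      using kc True dyadic_powi unfolding adj_def by auto
    then have "eventually (\<lambda>n. 2 ^ n * (2 powi (- k) * c) \<in> \<int>) sequentially"
      by (rule dyadic_eventually)
    moreover have "eventually (\<lambda>n. k \<le> int n) sequentially"
      unfolding eventually_sequentially by (intro exI[of _ "nat k"]) auto
    ultimately show ?thesis
      by eventually_elim (use kc in blast)
  qed simp
  then have "eventually (\<lambda>n. \<forall>a\<in>B. \<forall>b\<in>B. adj a b \<longrightarrow> (\<exists>k c. k \<le> int n \<and>
      2 ^ n * (2 powi (- k) * c) \<in> \<int> \<and> (\<forall>t\<in>{a..b}. g t = 2 powi k * t + c))) sequentially"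
    (is "eventually ?cells sequentially")
    using B(1) by (intro eventually_ball_finite ballI) auto
  moreover have "eventually (\<lambda>n. \<forall>b\<in>B. 2 ^ n * b \<in> \<int>) sequentially"
    (is "eventually ?grid sequentially")
    using B(1) Bdy by (intro eventually_ball_finite ballI dyadic_eventually) auto
  ultimately have "eventually (\<lambda>n. ?cells n \<and> ?grid n) sequentially"
    by (rule eventually_conj)
  then have "\<exists>n. ?cells n \<and> ?grid n"
    by (rule eventually_happens'[OF sequentially_bot])
  then obtain n where cells: "?cells n" and grid: "?grid n"
    by (elim exE conjE)
  have n: "\<exists>k c. k \<le> int n \<and> 2 ^ n * (2 powi (- k) * c) \<in> \<int> \<and>
      (\<forall>t\<in>{a..b}. g t = 2 powi k * t + c)" if "a \<in> B" "b \<in> B" "adj a b" for a b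
    using cells that by blast
  have nB: "2 ^ n * b \<in> \<int>" if "b \<in> B" for b
    using grid that by blast
  have "\<exists>v. carries f u v" if u: "length u = n" for u
  proof -
    obtain i :: int where i: "0 \<le> i" "i < 2 ^ n" "\<And>s. cyl u s = (of_int i + s) / 2 ^ n"
      using cyl_grid[of u] u by blast
    define p where "p = of_int i / (2 ^ n :: real)"
    have p: "0 \<le> p" "p < 1"
      using i of_int_less_iff[of i "2 ^ n", where 'a = real] by (auto simp: p_def)
    define a where "a = Max {b \<in> B. b \<le> p}"
    define b where "b = Min {b \<in> B. p < b}"
    have "a \<in> {b \<in> B. b \<le> p}" unfolding a_def using B p by (intro Max_in) auto
    then have a: "a \<in> B" "a \<le> p" by auto
    have "b \<in> {b \<in> B. p < b}" unfolding b_def using B p by (intro Min_in) auto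
    then have b: "b \<in> B" "p < b" by auto
    have "x \<le> a \<or> b \<le> x" if "x \<in> B" for x
      using that B(1) unfolding a_def b_def by (cases "x \<le> p") (auto intro: Max_ge Min_le)
    then have "adj a b" using a b unfolding adj_def by fastforce
    then obtain k c where k: "k \<le> int n" and c: "2 ^ n * (2 powi (- k) * c) \<in> \<int>"
      and g: "\<And>t. t \<in> {a..b} \<Longrightarrow> g t = 2 powi k * t + c"
      using n[OF a(1) b(1)] by blast
    have "(of_int i + 1) / 2 ^ n \<le> b"
    proof -
      obtain z where z: "2 ^ n * b = of_int z" using nB[OF b(1)] by (rule Ints_cases)
      have "of_int i < 2 ^ n * b" using b(2) by (simp add: p_def field_simps)
      then have "i + 1 \<le> z" unfolding z by simp
      then have "of_int i + 1 \<le> 2 ^ n * b" unfolding z by (metis of_int_1 of_int_add of_int_le_iff)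
      then show ?thesis by (simp add: field_simps)
    qed
    moreover have "p \<le> cyl u s" "cyl u s \<le> (of_int i + 1) / 2 ^ n" if "s \<in> I01" for s
      using that unfolding i(3) p_def by (simp_all add: divide_right_mono)
    ultimately have mem: "cyl u s \<in> {a..b}" if "s \<in> I01" for s
      using that a(2) by (meson atLeastAtMost_iff order_trans)
    define m where "m = nat (int n - k)"
    have pw: "2 powi k = (2 ^ n / 2 ^ m :: real)"
    proof -
      have "int n - int m = k" using k unfolding m_def by simp
      then show ?thesis by (metis power_int_diff power_int_of_nat zero_neq_numeral)
    qed
    have pw': "2 ^ n * (2 powi (- k) * c) = 2 ^ m * c"
      using pw by (simp add: power_int_minus field_simps)
    obtain z where z: "2 ^ m * c = of_int z" using c unfolding pw' by (rule Ints_cases)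
    obtain v where v: "\<And>s. s \<in> I01 \<Longrightarrow> frac ((of_int (i + z) + s) / 2 ^ m) = cyl v s"
      using frac_grid_cell by blast
    have "f (cyl u s) = cyl v s" if s: "s \<in> I01" for s
    proof -
      have "g (cyl u s) = (of_int i + s) / 2 ^ m + c"
        using g[OF mem[OF s]] i(3)[of s] pw by simp
      also have "\<dots> = (of_int (i + z) + s) / 2 ^ m"
        using z by (simp add: field_simps)
      finally have "frac (g (cyl u s)) = cyl v s" using v[OF s] by simp
      then show ?thesis
        using lift cyl_in[OF s, of u] unfolding circle_lift_def by (metis frac_eq_id)
    qed
    then show ?thesis unfolding carries_def by blast
  qed
  moreover have "finite {u :: bool list. length u = n}"
    using finite_lists_length_eq[of "UNIV :: bool set" n] by simp
  ultimately show ?thesis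
    unfolding pieces_def using covers_length[of n] by blast
qed

lemma continuous_integer_valued_constant:
  fixes h :: "real \<Rightarrow> real"
  assumes "a < b" "continuous_on {a..b} h" "\<And>t. t \<in> {a..<b} \<Longrightarrow> h t \<in> \<int>" "t \<in> {a..b}"
  shows "h t = h a"
proof -
  have "h constant_on {a..<b}"
  proof (rule continuous_discrete_range_constant)
    show "continuous_on {a..<b} h"
      using assms(2) by (rule continuous_on_subset) auto
    show "\<exists>e>0. \<forall>y. y \<in> {a..<b} \<and> h y \<noteq> h x \<longrightarrow> e \<le> norm (h y - h x)" if "x \<in> {a..<b}" for x
      using that assms(3) by (intro exI[of _ 1]) (auto intro!: Ints_nonzero_abs_ge1)
  qed auto
  then obtain y where y: "\<And>x. x \<in> {a..<b} \<Longrightarrow> h x = y"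
    unfolding constant_on_def by blast
  have const: "h x = h a" if "x \<in> {a..<b}" for x
    using y[OF that] y[of a] assms(1) by simp
  have "closure {a..<b} = {a..b}" using assms(1) by simp
  then have "continuous_on (closure {a..<b}) h" "t \<in> closure {a..<b}"
    using assms(2,4) by (simp_all only:)
  then show ?thesis
    using const continuous_constant_on_closure by blast
qed

text \<open>
  The breakpoints are the endpoints of the intervals of the cover. On an interval of linearity the
  lift differs from an affine function by an integer-valued continuous function, which is constant.
\<close>

lemma piecewise_linear_of_pieces:
  assumes lift: "circle_lift f g" and "pieces n f"
  shows "dyadic_piecewise_linear g"
proof -
  obtain P \<phi> where P: "finite P" "covers P" "\<And>u. u \<in> P \<Longrightarrow> carries f u (\<phi> u)"
    using \<open>pieces n f\<close> unfolding pieces_def by metis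
  define B where "B = {0, 1} \<union> (\<lambda>u. cyl u 0) ` P \<union> (\<lambda>u. cyl u 1) ` P"
  have end01: "cyl u 0 \<in> {0..1}" "cyl u 1 \<in> {0..1}" for u
    by (induction u) auto
  have "finite B" "{0, 1} \<subseteq> B" using P by (auto simp: B_def)
  moreover have "B \<subseteq> dyadics \<inter> {0..1}"
    using end01 dyadic_Ints[of 0] dyadic_Ints[of 1]
    by (auto simp: B_def dyadics_iff_dyadic dyadic_cyl)
  moreover have "\<exists>(k::int) c. \<forall>t\<in>{a..b}. g t = 2 powi k * t + c"
    if ab: "a \<in> B" "b \<in> B" "a < b" "{a<..<b} \<inter> B = {}" for a b
  proof -
    have "a \<in> {0..1}" "b \<in> {0..1}" using ab \<open>B \<subseteq> _\<close> by blast+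
    then have "a \<in> I01" using ab(3) by simp
    then obtain u s where u: "u \<in> P" "s \<in> I01" "a = cyl u s"
      using P(2) unfolding covers_def by blast
    have "a < cyl u 1" using u cyl_affine[of u s] cyl_affine[of u 1] by (simp add: divide_strict_right_mono)
    moreover have "cyl u 1 \<in> B" using u by (auto simp: B_def)
    ultimately have bu: "b \<le> cyl u 1" using ab(4) by (meson disjoint_iff greaterThanLessThan_iff not_le)
    define v where "v = \<phi> u"
    define k where "k = int (length u) - int (length v)"
    have pw: "2 powi k = (2 ^ length u / 2 ^ length v :: real)"
      unfolding k_def by (simp add: power_int_diff)
    define c where "c = cyl v 0 - 2 powi k * cyl u 0"
    have fr: "frac (g t) = 2 powi k * t + c" if t: "t \<in> {a..<b}" for t
    proof -
      define r where "r = (t - cyl u 0) * 2 ^ length u"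
      have tr: "t = cyl u r" using cyl_affine[of u r] by (simp add: r_def)
      have "0 \<le> s / 2 ^ length u" using u by simp
      moreover have "a \<le> t" using t by simp
      ultimately have "cyl u 0 \<le> t" using u(3) cyl_affine[of u s] by linarith
      then have "0 \<le> r" by (simp add: r_def)
      moreover have "t < cyl u 0 + 1 / 2 ^ length u"
        using t bu cyl_affine[of u 1] by simp
      then have "r < 1" by (simp add: r_def field_simps)
      ultimately have r: "r \<in> I01" by simp
      have "frac (g t) = f t"
        using lift tr cyl_in[OF r, of u] unfolding circle_lift_def by (metis frac_eq_id)
      also have "\<dots> = cyl v r"
        using P(3)[OF u(1)] r tr unfolding carries_def v_def by blast
      also have "\<dots> = 2 powi k * t + c"
        using cyl_affine[of v r] unfolding pw c_def r_def by (simp add: field_simps)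
      finally show ?thesis .
    qed
    define h where "h t = g t - (2 powi k * t + c)" for t
    have "continuous_on {a..b} g"
      using lift continuous_on_subset unfolding circle_lift_def by blast
    then have "continuous_on {a..b} h"
      unfolding h_def by (intro continuous_intros)
    moreover have "h t \<in> \<int>" if "t \<in> {a..<b}" for t
    proof -
      have "h t = of_int \<lfloor>g t\<rfloor>"
        using fr[OF that] by (simp add: h_def frac_def)
      then show ?thesis by simp
    qed
    ultimately have ht: "h t = h a" if "t \<in> {a..b}" for t
      using continuous_integer_valued_constant[OF ab(3)] that by blast
    have "g t = 2 powi k * t + (c + h a)" if "t \<in> {a..b}" for t
      using ht[OF that] h_def[of t] by linarith
    then show ?thesis by blast
  qed
  ultimately show ?thesis
    unfolding dyadic_piecewise_linear_def by (intro exI[of _ B]) simp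
qed

lemma pieces_dyadics:
  assumes "pieces n f"
  shows "f ` (dyadics \<inter> I01) \<subseteq> dyadics"
proof safe
  fix t :: real assume t: "t \<in> dyadics" "t \<in> I01"
  obtain u v s where u: "carries f u v" "s \<in> I01" "t = cyl u s"
    using assms t(2) unfolding pieces_def covers_def by metis
  then have "f t = cyl v s" unfolding carries_def by blast
  moreover have "dyadic s" using t(1) u dyadic_cyl dyadics_iff_dyadic by blast
  ultimately show "f t \<in> dyadics"
    using cyl_in[OF u(2), of v] dyadic_cyl dyadics_iff_dyadic by auto
qed

text \<open>
  Topology and breakpoints disappear: an element of T is a bijection with an increasing lift
  that has finitely many pieces. These properties are stable under composition and
  inversion, by \<open>pieces_compose\<close>, \<open>pieces_inverse\<close> and \<open>inverse_lift\<close>, which makes T a group.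
\<close>

theorem thompson_T_iff:
  "f \<in> thompson_T_set \<longleftrightarrow>
     f \<in> Bij I01 \<and> (\<exists>g. circle_lift f g \<and> strict_mono g) \<and> (\<exists>n. pieces n f)"
proof
  assume f: "f \<in> thompson_T_set"
  then have "bij_betw f I01 I01"
    unfolding thompson_T_set_def bij_betw_def
    by (metis (mono_tags, lifting) homeomorphic_imp_surjective_map homeomorphic_map_def mem_Collect_eq topspace_circle)
  with f have "f \<in> Bij I01" unfolding thompson_T_set_def Bij_def by blast
  then show "f \<in> Bij I01 \<and> (\<exists>g. circle_lift f g \<and> strict_mono g) \<and> (\<exists>n. pieces n f)"
    using f pieces_of_piecewise_linear unfolding thompson_T_set_def by blast
next
  assume f: "f \<in> Bij I01 \<and> (\<exists>g. circle_lift f g \<and> strict_mono g) \<and> (\<exists>n. pieces n f)"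
  then show "f \<in> thompson_T_set"
    using homeomorphic_map_of_lift piecewise_linear_of_pieces pieces_dyadics
    unfolding thompson_T_set_def Bij_def by blast
qed

lemma mult_BijGroup: "f \<in> Bij S \<Longrightarrow> g \<in> Bij S \<Longrightarrow> mult (BijGroup S) f g = compose S f g"
  by (simp add: BijGroup_def)

theorem subgroup_thompson_T: "subgroup thompson_T_set (BijGroup I01)"
proof (rule subgroup.intro)
  show "thompson_T_set \<subseteq> carrier (BijGroup I01)"
    by (auto simp: BijGroup_def thompson_T_iff)
next
  fix x y assume x: "x \<in> thompson_T_set" and y: "y \<in> thompson_T_set"
  obtain g h m n where g: "circle_lift x g" "strict_mono g" "pieces m x"
    and h: "circle_lift y h" "strict_mono h" "pieces n y"
    using x y unfolding thompson_T_iff by blast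
  have "circle_lift (compose I01 x y) (g \<circ> h)"
    unfolding circle_lift_def
  proof
    show "continuous_on UNIV (g \<circ> h)"
      using g(1) h(1) unfolding circle_lift_def
      by (intro continuous_on_compose) (auto intro: continuous_on_subset)
    show "\<forall>t. frac ((g \<circ> h) t) = compose I01 x y (frac t)"
      using g(1) h(1) frac_in_I01 unfolding circle_lift_def compose_def by simp
  qed
  moreover have "strict_mono (g \<circ> h)" using g h by (simp add: strict_mono_def)
  moreover have "pieces (n + m) (compose I01 x y)"
    using pieces_compose[OF _ h(3) g(3)] y by (simp add: thompson_T_iff)
  ultimately have "compose I01 x y \<in> thompson_T_set"
    using x y compose_Bij unfolding thompson_T_iff by blast
  then show "x \<otimes>\<^bsub>BijGroup I01\<^esub> y \<in> thompson_T_set"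
    using x y by (simp add: thompson_T_iff mult_BijGroup)
next
  have "circle_lift (\<lambda>t\<in>I01. t) (\<lambda>t. t)"
    unfolding circle_lift_def using frac_in_I01 by auto
  moreover have "strict_mono (\<lambda>t::real. t)" by (simp add: strict_mono_def)
  moreover have "pieces 1 (\<lambda>t\<in>I01. t)"
    unfolding pieces_def
  proof (intro exI conjI ballI)
    show "carries (\<lambda>t\<in>I01. t) u u" for u
      using cyl_in unfolding carries_def by simp
    show "covers {[]}" unfolding covers_def by auto
  qed auto
  ultimately have "(\<lambda>t\<in>I01. t) \<in> thompson_T_set"
    using id_Bij unfolding thompson_T_iff by blast
  then show "\<one>\<^bsub>BijGroup I01\<^esub> \<in> thompson_T_set"
    by (simp add: BijGroup_def)
next
  fix x assume x: "x \<in> thompson_T_set"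
  then have "(\<lambda>t\<in>I01. inv_into I01 x t) \<in> thompson_T_set"
    using inverse_lift pieces_inverse restrict_inv_into_Bij unfolding thompson_T_iff by metis
  then show "inv\<^bsub>BijGroup I01\<^esub> x \<in> thompson_T_set"
    using x by (simp add: thompson_T_iff inv_BijGroup)
qed

lemma subgroup_thompson_F: "subgroup {f \<in> thompson_T_set. f 0 = 0} (BijGroup I01)"
proof -
  interpret T: subgroup thompson_T_set "BijGroup I01" by (rule subgroup_thompson_T)
  have Bij: "x \<in> Bij I01" if "x \<in> thompson_T_set" for x
    using that thompson_T_iff by blast
  show ?thesis
  proof (rule subgroup.intro)
    show "{f \<in> thompson_T_set. f 0 = 0} \<subseteq> carrier (BijGroup I01)" using T.subset by blast
  next
    fix x y assume "x \<in> {f \<in> thompson_T_set. f 0 = 0}" "y \<in> {f \<in> thompson_T_set. f 0 = 0}"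
    then show "x \<otimes>\<^bsub>BijGroup I01\<^esub> y \<in> {f \<in> thompson_T_set. f 0 = 0}"
      using Bij T.m_closed by (auto simp: mult_BijGroup compose_def)
  next
    show "\<one>\<^bsub>BijGroup I01\<^esub> \<in> {f \<in> thompson_T_set. f 0 = 0}"
      using T.one_closed by (auto simp: BijGroup_def)
  next
    fix x assume x: "x \<in> {f \<in> thompson_T_set. f 0 = 0}"
    then have "inj_on x I01" using Bij by (auto simp: Bij_def bij_betw_def)
    then have "inv_into I01 x 0 = 0"
      using x inv_into_f_f[of x I01 0] by auto
    then show "inv\<^bsub>BijGroup I01\<^esub> x \<in> {f \<in> thompson_T_set. f 0 = 0}"
      using x T.m_inv_closed Bij by (auto simp: inv_BijGroup)
  qed
qed

section \<open>The generators\<close>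

text \<open>
  The lift is \<open>t \<mapsto> \<lfloor>t\<rfloor> + h (frac t)\<close>; being strictly increasing and onto, it is continuous.
\<close>

lemma thompson_T_memI:
  assumes h: "continuous_on {0..1} h" "strict_mono_on {0..1} h" "h 1 = h 0 + 1"
    and f: "f = (\<lambda>t\<in>I01. frac (h t))" and "pieces n f"
  shows "f \<in> thompson_T_set"
proof -
  define g where "g t = of_int \<lfloor>t\<rfloor> + h (frac t)" for t
  have less: "h s < h t" if "0 \<le> s" "s < t" "t \<le> 1" for s t
    using h(2) that by (auto simp: strict_mono_on_def)
  have h_le: "h 0 \<le> h (frac t)" "h (frac t) < h 0 + 1" for t
  proof -
    show "h 0 \<le> h (frac t)"
      using less[of 0 "frac t"] frac_lt_1[of t] frac_ge_0[of t] by (cases "frac t = 0") (auto simp del: frac_eq_0_iff frac_gt_0_iff)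
    show "h (frac t) < h 0 + 1"
      using less[of "frac t" 1] frac_lt_1[of t] frac_ge_0[of t] h(3) by simp
  qed
  have mono: "strict_mono g"
  proof (rule strict_monoI)
    fix s t :: real assume st: "s < t"
    show "g s < g t"
    proof (cases "\<lfloor>s\<rfloor> = \<lfloor>t\<rfloor>")
      case True
      then have "frac s < frac t" using st by (simp add: frac_def)
      then show ?thesis using less[of "frac s" "frac t"] frac_lt_1[of t] True by (simp add: g_def)
    next
      case False
      then have "\<lfloor>s\<rfloor> + 1 \<le> \<lfloor>t\<rfloor>" using st floor_mono[of s t] by linarith
      then have "of_int \<lfloor>s\<rfloor> + 1 \<le> (of_int \<lfloor>t\<rfloor> :: real)" by linarith
      then show ?thesis using h_le(2)[of s] h_le(1)[of t] by (simp add: g_def)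
    qed
  qed
  have ivt: "\<exists>t. t \<in> I01 \<and> h t = y" if y: "h 0 \<le> y" "y < h 0 + 1" for y
  proof -
    obtain t where "0 \<le> t" "t \<le> 1" "h t = y"
      using IVT'[of h 0 y 1] y h by auto
    then show ?thesis using y h(3) by (cases "t = 1") auto
  qed
  have "surj g"
  proof -
    have "\<exists>t. g t = y" for y
    proof -
      define n where "n = \<lfloor>y - h 0\<rfloor>"
      have "h 0 \<le> y - of_int n" "y - of_int n < h 0 + 1" unfolding n_def by linarith+
      then obtain t where t: "t \<in> I01" "h t = y - of_int n" using ivt by blast
      have "\<lfloor>of_int n + t\<rfloor> = n" using t by (intro floor_unique) auto
      moreover from this have "frac (of_int n + t) = t" by (simp add: frac_def)
      ultimately have "g (of_int n + t) = y" using t by (simp add: g_def)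
      then show ?thesis by blast
    qed
    then show ?thesis by (metis surjI)
  qed
  then have "continuous_on UNIV g" using mono continuous_of_strict_mono_surj by blast
  then have lift: "circle_lift f g"
    unfolding circle_lift_def using frac_in_I01 f by (auto simp: g_def)
  have "inj_on f I01"
  proof (rule inj_onI)
    fix s t assume st: "s \<in> I01" "t \<in> I01" "f s = f t"
    then have "frac (h s) = frac (h t)" using f by simp
    then obtain n where "h s = h t + of_int n" by (metis frac_eqE add.commute)
    moreover have "\<bar>h s - h t\<bar> < 1"
      using h_le[of s] h_le[of t] st by auto
    ultimately have "h s = h t" by auto
    then show "s = t" using st less[of s t] less[of t s] by (cases s t rule: linorder_cases) auto
  qed
  moreover have "f ` I01 = I01"
  proof
    show "f ` I01 \<subseteq> I01" using f frac_in_I01 by auto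
    show "I01 \<subseteq> f ` I01"
    proof
      fix y assume y: "y \<in> I01"
      define n where "n = \<lfloor>y - h 0\<rfloor>"
      have "h 0 \<le> y - of_int n" "y - of_int n < h 0 + 1" unfolding n_def by linarith+
      then obtain t where t: "t \<in> I01" "h t = y - of_int n" using ivt by blast
      have "frac (y - of_int n) = y"
        using y frac_add_of_int_right[of "y - of_int n" n] by simp
      then have "f t = y" using t f by simp
      then show "y \<in> f ` I01" using t by blast
    qed
  qed
  ultimately have "f \<in> Bij I01" using f by (simp add: Bij_def bij_betw_def)
  then show ?thesis using lift mono assms(5) unfolding thompson_T_iff by blast
qed

lemma x0_carries:
  "carries x0 [False] [False, False]"
  "carries x0 [True, False] [False, True]"
  "carries x0 [True, True] [True]"
  by (auto simp: carries_def x0_def field_simps)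

lemma x1_carries:
  "carries x1 [False] [False]"
  "carries x1 [True, False] [True, False, False]"
  "carries x1 [True, True, False] [True, False, True]"
  "carries x1 [True, True, True] [True, True]"
  by (auto simp: carries_def x1_def x0_def field_simps)

lemma c1_carries:
  "carries c1 [False] [True, True]"
  "carries c1 [True, False] [False]"
  "carries c1 [True, True] [True, False]"
  by (auto simp: carries_def c1_def field_simps)

lemma pieces_of_tree: "\<forall>u\<in>set (leaves t). \<exists>v. carries f u v \<Longrightarrow> pieces (length (leaves t)) f"
  unfolding pieces_def using covers_leaves card_length by blast

lemma x0_in_T: "x0 \<in> thompson_T_set"
proof (rule thompson_T_memI)
  \<comment> \<open>\<open>x0\<close> is convex, so it is the maximum of its affine pieces\<close>
  let ?h = "\<lambda>t::real. max (t / 2) (max (t - 1/4) (2 * t - 1))"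
  show "continuous_on {0..1} ?h" by (intro continuous_intros) auto
  show "strict_mono_on {0..1} ?h" by (auto simp: strict_mono_on_def max_def)
  show "?h 1 = ?h 0 + 1" by simp
  have "x0 t = frac (?h t)" if "t \<in> I01" for t
  proof -
    have "x0 t = ?h t" using that by (auto simp: x0_def max_def)
    moreover have "?h t \<in> I01" using that by (auto simp: max_def)
    ultimately show ?thesis by simp
  qed
  then show "x0 = (\<lambda>t\<in>I01. frac (?h t))"
    by (auto simp: fun_eq_iff x0_def)
  show "pieces (length (leaves (Node Leaf (Node Leaf Leaf)))) x0"
    using x0_carries by (intro pieces_of_tree) auto
qed

lemma x1_in_T: "x1 \<in> thompson_T_set"
proof (rule thompson_T_memI)
  \<comment> \<open>to the right of \<open>1/2\<close> the map \<open>x1\<close> is convex and lies below the diagonal\<close>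
  let ?h = "\<lambda>t::real. min t (max (t / 2 + 1/4) (max (t - 1/8) (2 * t - 1)))"
  show "continuous_on {0..1} ?h" by (intro continuous_intros) auto
  show "strict_mono_on {0..1} ?h" by (auto simp: strict_mono_on_def max_def min_def)
  show "?h 1 = ?h 0 + 1" by simp
  have "x1 t = frac (?h t)" if "t \<in> I01" for t
  proof -
    have "x1 t = ?h t" using that by (auto simp: x1_def x0_def max_def min_def field_simps)
    moreover have "?h t \<in> I01" using that by (auto simp: max_def min_def)
    ultimately show ?thesis by simp
  qed
  then show "x1 = (\<lambda>t\<in>I01. frac (?h t))"
    by (auto simp: fun_eq_iff x1_def)
  show "pieces (length (leaves (Node Leaf (Node Leaf (Node Leaf Leaf))))) x1"
    using x1_carries by (intro pieces_of_tree) auto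
qed

lemma c1_in_T: "c1 \<in> thompson_T_set"
proof (rule thompson_T_memI)
  \<comment> \<open>\<open>c1\<close> lifted to \<open>[3/4, 7/4]\<close>: the pieces are \<open>c1\<close>, and \<open>c1 + 1\<close> from \<open>t = 1/2\<close> on\<close>
  let ?h = "\<lambda>t::real. max (t / 2 + 3/4) (min (2 * t) (t + 3/4))"
  show "continuous_on {0..1} ?h" by (intro continuous_intros) auto
  show "strict_mono_on {0..1} ?h" by (auto simp: strict_mono_on_def max_def min_def)
  show "?h 1 = ?h 0 + 1" by simp
  have "frac (?h t) = c1 t" if "t \<in> I01" for t
  proof (cases "t < 1/2")
    case True
    then show ?thesis
      using that by (auto simp: c1_def max_def min_def)
  next
    case False
    then have "c1 t = ?h t - 1" "c1 t \<in> I01"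
      using that by (auto simp: c1_def max_def min_def)
    then show ?thesis by (simp add: frac_unique_iff)
  qed
  then show "c1 = (\<lambda>t\<in>I01. frac (?h t))"
    by (auto simp: fun_eq_iff c1_def)
  show "pieces (length (leaves (Node Leaf (Node Leaf Leaf)))) c1"
    using c1_carries by (intro pieces_of_tree) auto
qed

section \<open>The groups F and T\<close>

lemma carrier_T: "carrier thompson_T = thompson_T_set"
  by (simp add: thompson_T_def)

lemma carrier_F: "carrier thompson_F = {f \<in> thompson_T_set. f 0 = 0}"
  by (simp add: thompson_F_def)

lemma carrier_T_Bij: "f \<in> carrier thompson_T \<Longrightarrow> f \<in> Bij I01"
  by (simp add: carrier_T thompson_T_iff)

lemma F_sub_T: "carrier thompson_F \<subseteq> carrier thompson_T"
  by (auto simp: carrier_T carrier_F)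

interpretation T: group thompson_T
  unfolding thompson_T_def
  using subgroup_thompson_T group_BijGroup by (rule subgroup.subgroup_is_group)

interpretation F: group thompson_F
  unfolding thompson_F_def
  using subgroup_thompson_F group_BijGroup by (rule subgroup.subgroup_is_group)

lemma thompson_F_eq: "thompson_F = thompson_T\<lparr>carrier := carrier thompson_F\<rparr>"
  by (simp add: thompson_F_def thompson_T_def)

lemma subgroup_F_T: "subgroup (carrier thompson_F) thompson_T"
proof -
  have "subgroup {f \<in> thompson_T_set. f 0 = 0} (BijGroup I01\<lparr>carrier := thompson_T_set\<rparr>)"
    by (rule group.subgroup_incl[OF group_BijGroup subgroup_thompson_F subgroup_thompson_T]) blast
  then show ?thesis by (simp add: carrier_F thompson_T_def)
qed

lemma mult_T:
  "f \<in> carrier thompson_T \<Longrightarrow> g \<in> carrier thompson_T \<Longrightarrow>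
    f \<otimes>\<^bsub>thompson_T\<^esub> g = compose I01 f g"
  using carrier_T_Bij[of f] carrier_T_Bij[of g] by (simp add: thompson_T_def mult_BijGroup)

lemma mult_F:
  "f \<in> carrier thompson_F \<Longrightarrow> g \<in> carrier thompson_F \<Longrightarrow>
    f \<otimes>\<^bsub>thompson_F\<^esub> g = compose I01 f g"
  using mult_T[of f g] F_sub_T by (auto simp: thompson_F_def thompson_T_def)

lemma inv_F:
  assumes "f \<in> carrier thompson_F"
  shows "inv\<^bsub>thompson_F\<^esub> f = (\<lambda>t\<in>I01. inv_into I01 f t)"
proof -
  have "inv\<^bsub>thompson_F\<^esub> f = inv\<^bsub>BijGroup I01\<^esub> f"
    unfolding thompson_F_def
    using group.m_inv_consistent[OF group_BijGroup subgroup_thompson_F] assms by (simp add: carrier_F)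
  then show ?thesis
    using inv_BijGroup carrier_T_Bij F_sub_T assms by (metis subsetD)
qed

lemma carries_mult_F:
  assumes "f \<in> carrier thompson_F" "g \<in> carrier thompson_F" "carries g u v" "carries f v w"
  shows "carries (f \<otimes>\<^bsub>thompson_F\<^esub> g) u w"
  using assms carries_compose by (simp add: mult_F)

lemma carries_inv_F:
  assumes "f \<in> carrier thompson_F" "carries f u v"
  shows "carries (inv\<^bsub>thompson_F\<^esub> f) v u"
  using assms carries_inverse[of f u v] carrier_T_Bij F_sub_T by (simp add: inv_F subset_iff)

text \<open>
  The lift of a map that fixes \<open>0\<close> starts at an integer, and injectivity keeps it from reaching the next integer before \<open>t = 1\<close>.
\<close>

lemma F_strict_mono:
  assumes f: "f \<in> carrier thompson_F"
  shows "strict_mono_on I01 f"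
proof -
  obtain g where g: "circle_lift f g" "strict_mono g" and "f \<in> Bij I01" and f0: "f 0 = 0"
    using f unfolding carrier_F thompson_T_iff by blast
  then have inj: "inj_on f I01" by (simp add: Bij_def bij_betw_def)
  have lift: "frac (g t) = f t" if "t \<in> I01" for t
    using g(1) that unfolding circle_lift_def by (metis frac_eq_id)
  then have "frac (g 0) = 0" using f0 by simp
  then obtain n where n: "g 0 = of_int n" by (metis Ints_cases frac_eq_0_iff)
  have "f t = g t - of_int n" if t: "t \<in> I01" for t
  proof -
    have "g 0 \<le> g t" using g(2) t by (simp add: strict_mono_less_eq)
    moreover have "g t < g 0 + 1"
    proof (rule ccontr)
      assume "\<not> g t < g 0 + 1"
      moreover have "continuous_on {0..t} g"
        using g(1) continuous_on_subset unfolding circle_lift_def by blast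
      ultimately obtain s where s: "0 \<le> s" "s \<le> t" "g s = g 0 + 1"
        using IVT'[of g 0 "g 0 + 1" t] t by auto
      then have "f s = 0"
        using lift[of s] t n by (simp add: frac_1_eq)
      then have "s = 0"
        using inj_onD[OF inj, of s 0] f0 s t by simp
      then show False using s by simp
    qed
    ultimately have "frac (g t) = g t - of_int n"
      using n by (simp add: frac_unique_iff)
    then show ?thesis using lift[OF t] by simp
  qed
  then show ?thesis
    using g(2) by (auto simp: strict_mono_on_def strict_mono_def)
qed

section \<open>Words from trees\<close>

primrec carets :: "tree \<Rightarrow> nat" where
  "carets Leaf = 0"
| "carets (Node l r) = Suc (carets l + carets r)"

primrec spine :: "tree \<Rightarrow> nat" where
  "spine Leaf = 0"
| "spine (Node l r) = Suc (spine r)"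

text \<open>
  The normal form to which all trees with \<open>n\<close> carets are compared.
\<close>

primrec comb :: "nat \<Rightarrow> tree" where
  "comb 0 = Leaf"
| "comb (Suc n) = Node Leaf (comb n)"

lemma spine_le_carets: "spine t \<le> carets t"
  by (induction t) auto

lemma length_leaves: "length (leaves t) = Suc (carets t)"
  by (induction t) auto

lemma generators_in_F: "x0 \<in> carrier thompson_F" "x1 \<in> carrier thompson_F"
  using x0_in_T x1_in_T by (auto simp: carrier_F x0_def x1_def)

lemma generators_F: "{x0, x1} \<subseteq> carrier thompson_F"
  using generators_in_F by simp

lemmas in_ball_mult_F = F.in_ball_mult[OF generators_F]
lemmas in_ball_closed_F = F.in_ball_closed[OF generators_F]

lemma all_carries_mult_F:
  assumes "f \<in> carrier thompson_F" "g \<in> carrier thompson_F"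
    "list_all2 (carries g) us vs" "list_all2 (carries f) vs ws"
  shows "list_all2 (carries (f \<otimes>\<^bsub>thompson_F\<^esub> g)) us ws"
  using list_all2_trans[OF carries_mult_F[OF assms(1,2)] assms(3,4)] .

lemma all_carries_append:
  assumes "carries f u v"
  shows "list_all2 (carries f) (map (\<lambda>x. u @ x) xs) (map (\<lambda>x. v @ x) xs)"
  using carries_append[OF assms] by (simp add: list_all2_map1 list_all2_map2 list_all2_same)

definition combs_right_half :: "(real \<Rightarrow> real) \<Rightarrow> tree \<Rightarrow> bool" where
  "combs_right_half W t \<longleftrightarrow> carries W [False] [False] \<and>
     list_all2 (carries W) (map (Cons True) (leaves t)) (map (Cons True) (leaves (comb (carets t))))"

text \<open>
  The elements \<open>W\<close> fix the left half of the interval, and the tree \<open>t\<close> subdivides the right half. If the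
  left child of \<open>t\<close> is a caret, the inverse of \<open>x1\<close> is the rotation that turns
  \<open>Node (Node a b) r\<close> into \<open>Node a (Node b r)\<close>. If the left child is a leaf, that leaf is finished, and
  \<open>x0\<close> stretches the last quarter, where \<open>r\<close> lives, to the right half; conjugation by \<open>x0\<close> then
  reduces \<open>t\<close> to \<open>r\<close>.

  The number \<open>3 * carets t - spine t\<close> counts the letters: a rotation uses one letter and lengthens the
  right spine by one, while passing to \<open>r\<close> uses two letters, removes one caret and
  shortens the spine by one. The conjugating letters of successive steps do not add up, because each
  step works in the frame of the previous one; this is what keeps the length linear.
\<close>

lemma comb_right_half:
  "\<exists>W. in_ball thompson_F {x0, x1} (3 * carets t - spine t) W \<and> combs_right_half W t"
proof (induction "3 * carets t - spine t" arbitrary: t rule: less_induct)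
  case less
  show ?case
  proof (cases t)
    case Leaf
    have "carries \<one>\<^bsub>thompson_F\<^esub> u u" for u
      using cyl_in by (auto simp: carries_def thompson_F_def BijGroup_def)
    then have "combs_right_half \<one>\<^bsub>thompson_F\<^esub> t"
      by (simp add: combs_right_half_def Leaf)
    then show ?thesis using F.in_ball_one by blast
  next
    case (Node l r)
    show ?thesis
    proof (cases l)
      case Leaf
      have pot: "3 * carets t - spine t = 1 + ((3 * carets r - spine r) + 1)"
        using spine_le_carets[of r] by (simp add: Node Leaf)
      then obtain W where W: "in_ball thompson_F {x0, x1} (3 * carets r - spine r) W"
        and c: "combs_right_half W r"
        using less[of r] by auto
      let ?x = "inv\<^bsub>thompson_F\<^esub> x0"
      let ?V = "W \<otimes>\<^bsub>thompson_F\<^esub> x0"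
      have V: "in_ball thompson_F {x0, x1} ((3 * carets r - spine r) + 1) ?V"
        by (rule in_ball_mult_F[OF W F.in_ball_gen[OF generators_F]]) simp
      have U: "in_ball thompson_F {x0, x1} (3 * carets t - spine t) (?x \<otimes>\<^bsub>thompson_F\<^esub> ?V)"
        unfolding pot by (rule in_ball_mult_F[OF F.in_ball_gen_inv[OF generators_F] V]) simp
      have mem: "W \<in> carrier thompson_F" "?V \<in> carrier thompson_F" "?x \<in> carrier thompson_F"
        using W V in_ball_closed_F generators_in_F by auto
      have fixed: "carries W ([False] @ u) ([False] @ u)" for u
        using c carries_append unfolding combs_right_half_def by blast
      have "combs_right_half (?x \<otimes>\<^bsub>thompson_F\<^esub> ?V) t"
        unfolding combs_right_half_def
      proof
        have "carries ?V [False] [False, False]"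
          using fixed[of "[False]"] by (intro carries_mult_F[OF mem(1) generators_in_F(1) x0_carries(1)]) simp
        then show "carries (?x \<otimes>\<^bsub>thompson_F\<^esub> ?V) [False] [False]"
          using carries_inv_F[OF generators_in_F(1) x0_carries(1)] by (rule carries_mult_F[OF mem(3,2)])
        have "carries ?V [True, False] [False, True]"
          using fixed[of "[True]"] by (intro carries_mult_F[OF mem(1) generators_in_F(1) x0_carries(2)]) simp
        then have 1: "carries (?x \<otimes>\<^bsub>thompson_F\<^esub> ?V) [True, False] [True, False]"
          using carries_inv_F[OF generators_in_F(1) x0_carries(2)] by (rule carries_mult_F[OF mem(3,2)])
        have "list_all2 (carries ?V) (map (\<lambda>x. [True, True] @ x) (leaves r))
            (map (Cons True) (leaves (comb (carets r))))"
          using all_carries_append[OF x0_carries(3), of "leaves r"] c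
          unfolding combs_right_half_def
          by (intro all_carries_mult_F[OF mem(1) generators_in_F(1)]) auto
        then have 2: "list_all2 (carries (?x \<otimes>\<^bsub>thompson_F\<^esub> ?V)) (map (\<lambda>x. [True, True] @ x) (leaves r))
            (map (\<lambda>x. [True, True] @ x) (leaves (comb (carets r))))"
          using all_carries_append[OF carries_inv_F[OF generators_in_F(1) x0_carries(3)],
              of "leaves (comb (carets r))"]
          by (intro all_carries_mult_F[OF mem(3,2)]) auto
        show "list_all2 (carries (?x \<otimes>\<^bsub>thompson_F\<^esub> ?V)) (map (Cons True) (leaves t))
            (map (Cons True) (leaves (comb (carets t))))"
          using 1 2 by (simp add: Node Leaf comp_def)
      qed
      then show ?thesis using U by blast
    next
      case l: (Node a b)
      let ?t = "Node a (Node b r)"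
      have pot: "3 * carets t - spine t = (3 * carets ?t - spine ?t) + 1"
        using spine_le_carets[of r] by (simp add: Node l)
      then obtain W where W: "in_ball thompson_F {x0, x1} (3 * carets ?t - spine ?t) W"
        and c: "combs_right_half W ?t"
        using less[of ?t] by auto
      let ?x = "inv\<^bsub>thompson_F\<^esub> x1"
      have U: "in_ball thompson_F {x0, x1} (3 * carets t - spine t) (W \<otimes>\<^bsub>thompson_F\<^esub> ?x)"
        unfolding pot by (rule in_ball_mult_F[OF W F.in_ball_gen_inv[OF generators_F]]) simp
      have mem: "W \<in> carrier thompson_F" "?x \<in> carrier thompson_F"
        using W in_ball_closed_F generators_in_F by auto
      note x = x1_carries[THEN carries_inv_F[OF generators_in_F(2)]]
      have "combs_right_half (W \<otimes>\<^bsub>thompson_F\<^esub> ?x) t"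
        unfolding combs_right_half_def
      proof
        show "carries (W \<otimes>\<^bsub>thompson_F\<^esub> ?x) [False] [False]"
          using c x(1) unfolding combs_right_half_def by (intro carries_mult_F[OF mem]) auto
        have "list_all2 (carries ?x) (map (Cons True) (leaves t)) (map (Cons True) (leaves ?t))"
          using all_carries_append[OF x(2), of "leaves a"] all_carries_append[OF x(3), of "leaves b"]
            all_carries_append[OF x(4), of "leaves r"]
          by (simp add: Node l comp_def list_all2_appendI)
        moreover have "carets ?t = carets t" by (simp add: Node l)
        ultimately show "list_all2 (carries (W \<otimes>\<^bsub>thompson_F\<^esub> ?x)) (map (Cons True) (leaves t))
            (map (Cons True) (leaves (comb (carets t))))"
          using c unfolding combs_right_half_def by (metis all_carries_mult_F[OF mem])
      qed
      then show ?thesis using U by blast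
    qed
  qed
qed

text \<open>
  Rotations at the root of the whole tree are made by the inverse of \<open>x0\<close>. Once the left child is a leaf,
  the left half is finished and only the right half has to be combed.
\<close>

lemma comb_tree:
  "\<exists>W. in_ball thompson_F {x0, x1} (3 * carets t - spine t) W \<and>
     list_all2 (carries W) (leaves t) (leaves (comb (carets t)))"
proof (induction "3 * carets t - spine t" arbitrary: t rule: less_induct)
  case less
  show ?case
  proof (cases t)
    case Leaf
    have "carries \<one>\<^bsub>thompson_F\<^esub> u u" for u
      using cyl_in by (auto simp: carries_def thompson_F_def BijGroup_def)
    then show ?thesis using F.in_ball_one Leaf by (intro exI[of _ "\<one>\<^bsub>thompson_F\<^esub>"]) simp
  next
    case (Node l r)
    show ?thesis
    proof (cases l)
      case Leaf
      obtain W where W: "in_ball thompson_F {x0, x1} (3 * carets r - spine r) W" "combs_right_half W r"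
        using comb_right_half by blast
      have "in_ball thompson_F {x0, x1} (3 * carets t - spine t) W"
        using W(1) by (rule in_ball_mono) (simp add: Node Leaf)
      moreover have "list_all2 (carries W) (leaves t) (leaves (comb (carets t)))"
        using W(2) by (simp add: combs_right_half_def Node Leaf)
      ultimately show ?thesis by blast
    next
      case l: (Node a b)
      let ?t = "Node a (Node b r)"
      have pot: "3 * carets t - spine t = (3 * carets ?t - spine ?t) + 1"
        using spine_le_carets[of r] by (simp add: Node l)
      then obtain W where W: "in_ball thompson_F {x0, x1} (3 * carets ?t - spine ?t) W"
        and c: "list_all2 (carries W) (leaves ?t) (leaves (comb (carets ?t)))"
        using less[of ?t] by auto
      let ?x = "inv\<^bsub>thompson_F\<^esub> x0"
      have U: "in_ball thompson_F {x0, x1} (3 * carets t - spine t) (W \<otimes>\<^bsub>thompson_F\<^esub> ?x)"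
        unfolding pot by (rule in_ball_mult_F[OF W F.in_ball_gen_inv[OF generators_F]]) simp
      have mem: "W \<in> carrier thompson_F" "?x \<in> carrier thompson_F"
        using W in_ball_closed_F generators_in_F by auto
      note x = x0_carries[THEN carries_inv_F[OF generators_in_F(1)]]
      have "list_all2 (carries ?x) (leaves t) (leaves ?t)"
        using all_carries_append[OF x(1), of "leaves a"] all_carries_append[OF x(2), of "leaves b"]
          all_carries_append[OF x(3), of "leaves r"]
        by (simp add: Node l comp_def list_all2_appendI)
      moreover have "carets ?t = carets t" by (simp add: Node l)
      ultimately have "list_all2 (carries (W \<otimes>\<^bsub>thompson_F\<^esub> ?x)) (leaves t) (leaves (comb (carets t)))"
        using c by (metis all_carries_mult_F[OF mem])
      then show ?thesis using U by blast
    qed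
  qed
qed

lemma carries_leaves_unique:
  assumes "f \<in> extensional I01" "g \<in> extensional I01"
    and "list_all2 (carries f) (leaves t) vs" "list_all2 (carries g) (leaves t) vs"
  shows "f = g"
proof (rule extensionalityI[OF assms(1,2)])
  fix x assume "x \<in> I01"
  then obtain u s where u: "u \<in> set (leaves t)" "s \<in> I01" "x = cyl u s"
    using covers_leaves unfolding covers_def by blast
  then obtain i where "i < length (leaves t)" "u = leaves t ! i"
    by (metis in_set_conv_nth)
  then have "carries f u (vs ! i)" "carries g u (vs ! i)"
    using assms(3,4) by (auto simp: list_all2_conv_all_nth)
  then show "f x = g x" using u unfolding carries_def by simp
qed

text \<open>
  Both trees of a tree diagram have the same number of leaves and so are combed to the same comb.
  Hence \<open>f\<close> is the element that combs the first tree followed by the inverse of the one that combs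
  the second.
\<close>

theorem F_length_le_pieces:
  assumes f: "f \<in> carrier thompson_F" and "pieces n f"
  shows "in_ball thompson_F {x0, x1} (6 * n) f"
proof -
  have "f \<in> Bij I01" using f carrier_T_Bij F_sub_T by blast
  then obtain t t' where t: "length (leaves t) \<le> n" and f_t: "list_all2 (carries f) (leaves t) (leaves t')"
    using tree_pair[OF _ F_strict_mono[OF f] \<open>pieces n f\<close>] by blast
  obtain W where W: "in_ball thompson_F {x0, x1} (3 * carets t - spine t) W"
    "list_all2 (carries W) (leaves t) (leaves (comb (carets t)))"
    using comb_tree by blast
  obtain V where V: "in_ball thompson_F {x0, x1} (3 * carets t' - spine t') V"
    "list_all2 (carries V) (leaves t') (leaves (comb (carets t')))"
    using comb_tree by blast
  have eq: "carets t' = carets t"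
    using list_all2_lengthD[OF f_t] by (simp add: length_leaves)
  have mem: "W \<in> carrier thompson_F" "V \<in> carrier thompson_F"
    using W V in_ball_closed_F by auto
  have "list_all2 (carries (V \<otimes>\<^bsub>thompson_F\<^esub> f)) (leaves t) (leaves (comb (carets t)))"
    using all_carries_mult_F[OF mem(2) f f_t] V(2) eq by simp
  moreover have "g \<in> extensional I01" if "g \<in> carrier thompson_F" for g
    using that carrier_T_Bij F_sub_T Bij_imp_extensional by blast
  ultimately have "V \<otimes>\<^bsub>thompson_F\<^esub> f = W"
    using carries_leaves_unique W(2) mem f by (metis F.m_closed)
  then have "f = inv\<^bsub>thompson_F\<^esub> V \<otimes>\<^bsub>thompson_F\<^esub> W"
    using F.inv_solve_left[OF f mem(2,1)] by simp
  moreover have "in_ball thompson_F {x0, x1} ((3 * carets t' - spine t') + (3 * carets t - spine t))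
      (inv\<^bsub>thompson_F\<^esub> V \<otimes>\<^bsub>thompson_F\<^esub> W)"
    by (rule in_ball_mult_F[OF F.in_ball_inv[OF generators_F V(1)] W(1)])
  moreover have "(3 * carets t' - spine t') + (3 * carets t - spine t) \<le> 6 * n"
    using t eq by (simp add: length_leaves)
  ultimately show ?thesis by (simp only: in_ball_mono)
qed

text \<open>
  By subadditivity the number of pieces grows at most linearly along a word; \<open>K\<close> bounds the pieces of
  the letters, and the empty word has one piece.
\<close>

lemma pieces_le_T_length:
  assumes B: "finite B" "B \<subseteq> carrier thompson_T"
  shows "\<exists>K. \<forall>n f. in_ball thompson_T B n f \<longrightarrow> pieces (K * n + 1) f"
proof -
  let ?L = "B \<union> m_inv thompson_T ` B"
  have LT: "?L \<subseteq> carrier thompson_T" using T.letters_closed[OF B(2)] .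
  then have "\<forall>b\<in>?L. \<exists>n. pieces n b" by (auto simp: carrier_T thompson_T_iff subset_iff)
  then obtain k where k: "\<And>b. b \<in> ?L \<Longrightarrow> pieces (k b) b" by metis
  define K where "K = Max (insert 0 (k ` ?L))"
  have K: "pieces K b" if "b \<in> ?L" for b
  proof -
    have "k b \<le> K" unfolding K_def using that B(1) by (intro Max_ge) auto
    then show ?thesis using k[OF that] pieces_mono by blast
  qed
  have word: "pieces (K * length ws + 1) (foldr (mult thompson_T) ws \<one>\<^bsub>thompson_T\<^esub>)"
    if "set ws \<subseteq> ?L" for ws
    using that
  proof (induction ws)
    case Nil
    have "carries \<one>\<^bsub>thompson_T\<^esub> [] []" by (simp add: carries_def thompson_T_def BijGroup_def)
    then show ?case using pieces_of_tree[of Leaf "\<one>\<^bsub>thompson_T\<^esub>"] by auto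
  next
    case (Cons w ws)
    let ?g = "foldr (mult thompson_T) ws \<one>\<^bsub>thompson_T\<^esub>"
    have w: "w \<in> ?L" and ws: "set ws \<subseteq> ?L" using Cons.prems by auto
    then have "w \<in> carrier thompson_T" "?g \<in> carrier thompson_T"
      using LT T.foldr_mult_closed[of ws] by (blast, metis order_trans)
    moreover from this have "pieces ((K * length ws + 1) + K) (compose I01 w ?g)"
      using pieces_compose[OF carrier_T_Bij Cons.IH[OF ws] K[OF w]] by blast
    ultimately show ?case by (simp add: mult_T algebra_simps)
  qed
  have "pieces (K * n + 1) f" if "in_ball thompson_T B n f" for n f
  proof -
    obtain ws where "length ws \<le> n" "set ws \<subseteq> ?L" "foldr (mult thompson_T) ws \<one>\<^bsub>thompson_T\<^esub> = f"
      using \<open>in_ball thompson_T B n f\<close> unfolding in_ball_def by blast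
    then show ?thesis using word[of ws] pieces_mono by fastforce
  qed
  then show ?thesis by blast
qed

section \<open>The quasi-isometric embedding\<close>

lemma F_generated: "generate thompson_F {x0, x1} = carrier thompson_F"
proof
  show "generate thompson_F {x0, x1} \<subseteq> carrier thompson_F"
    using F.generate_in_carrier[OF generators_F] by blast
  show "carrier thompson_F \<subseteq> generate thompson_F {x0, x1}"
  proof
    fix f assume f: "f \<in> carrier thompson_F"
    then obtain n where "pieces n f" unfolding carrier_F thompson_T_iff by blast
    then show "f \<in> generate thompson_F {x0, x1}"
      using F_length_le_pieces[OF f] F.generate_in_ball by blast
  qed
qed

text \<open>
  The hypothesis on \<open>B\<close> is that it generates a subgroup of T that contains F. For
  \<open>{x0, x1, c1}\<close> this follows from the generation of F by \<open>{x0, x1}\<close>.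
\<close>

theorem F_in_T_quasi_isometric:
  assumes A: "finite A" "A \<subseteq> carrier thompson_F" "generate thompson_F A = carrier thompson_F"
    and B: "finite B" "B \<subseteq> carrier thompson_T" "carrier thompson_F \<subseteq> generate thompson_T B"
  shows "quasi_isometric_embedding (carrier thompson_F) (word_metric thompson_F A)
           (carrier thompson_T) (word_metric thompson_T B) (\<lambda>w. w)"
proof -
  have F_ball: "\<exists>n. in_ball thompson_F A n f" if "f \<in> carrier thompson_F" for f
    using F.in_ball_generate[OF A(2)] A(3) that by simp
  have T_ball: "\<exists>n. in_ball thompson_T B n f" if "f \<in> carrier thompson_F" for f
    using T.in_ball_generate[OF B(2)] B(3) that by blast
  obtain K1 where K1: "\<forall>a\<in>A. in_ball thompson_T B K1 a"
    using T.finite_in_ball_bound[OF A(1)] T_ball A(2) by blast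
  obtain K2 where K2: "\<forall>x\<in>{x0, x1}. in_ball thompson_F A K2 x"
    using F.finite_in_ball_bound[of "{x0, x1}"] F_ball generators_F by blast
  obtain N where N: "\<And>n f. in_ball thompson_T B n f \<Longrightarrow> pieces (N * n + 1) f"
    using pieces_le_T_length[OF B(1,2)] by blast
  have upper: "word_length thompson_T B h \<le> K1 * word_length thompson_F A h"
    if h: "h \<in> carrier thompson_F" for h
  proof -
    have "in_ball thompson_F A (word_length thompson_F A h) h"
      using F_ball[OF h] by (auto intro: in_ball_word_length)
    then have "in_ball thompson_T A (word_length thompson_F A h) h"
      using T.in_ball_subgroup[OF subgroup_F_T A(2)] thompson_F_eq by metis
    then have "in_ball thompson_T B (K1 * word_length thompson_F A h) h"
      using T.in_ball_change_generators[OF B(2)] K1 by blast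
    then show ?thesis by (rule word_length_le)
  qed
  have lower: "word_length thompson_F A h \<le> 6 * K2 * N * word_length thompson_T B h + 6 * K2"
    if h: "h \<in> carrier thompson_F" for h
  proof -
    let ?n = "word_length thompson_T B h"
    have "in_ball thompson_T B ?n h"
      using T_ball[OF h] by (auto intro: in_ball_word_length)
    then have "in_ball thompson_F {x0, x1} (6 * (N * ?n + 1)) h"
      by (intro F_length_le_pieces[OF h] N)
    then have "in_ball thompson_F A (K2 * (6 * (N * ?n + 1))) h"
      using F.in_ball_change_generators[OF A(2)] K2 by blast
    then have "word_length thompson_F A h \<le> K2 * (6 * (N * ?n + 1))"
      by (rule word_length_le)
    then show ?thesis by (simp add: algebra_simps)
  qed
  define K where "K = real (K1 + 6 * K2 * N + 1)"
  define C where "C = real (6 * K2)"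
  have K: "K \<ge> 1" "C \<ge> 0" unfolding K_def C_def by simp_all
  have "1 / K * word_metric thompson_F A w z - C \<le> word_metric thompson_T B w z \<and>
      word_metric thompson_T B w z \<le> K * word_metric thompson_F A w z + C"
    if wz: "w \<in> carrier thompson_F" "z \<in> carrier thompson_F" for w z
  proof -
    define h where "h = inv\<^bsub>thompson_F\<^esub> w \<otimes>\<^bsub>thompson_F\<^esub> z"
    have h: "h \<in> carrier thompson_F" unfolding h_def using wz by simp
    have "inv\<^bsub>thompson_F\<^esub> w = inv\<^bsub>thompson_T\<^esub> w"
      using T.m_inv_consistent[OF subgroup_F_T wz(1)] thompson_F_eq by metis
    moreover have "mult thompson_F = mult thompson_T"
      by (simp add: thompson_F_def thompson_T_def)
    ultimately have hT: "inv\<^bsub>thompson_T\<^esub> w \<otimes>\<^bsub>thompson_T\<^esub> z = h"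
      unfolding h_def by simp
    define p where "p = real (word_length thompson_F A h)"
    define q where "q = real (word_length thompson_T B h)"
    have pq: "word_metric thompson_F A w z = p" "word_metric thompson_T B w z = q"
      unfolding word_metric_def hT p_def q_def h_def[symmetric] by simp_all
    have pos: "p \<ge> 0" "q \<ge> 0" unfolding p_def q_def by simp_all
    have "q \<le> real K1 * p"
      unfolding p_def q_def using upper[OF h] by (metis of_nat_le_iff of_nat_mult)
    also have "\<dots> \<le> K * p" using pos by (intro mult_right_mono) (simp_all add: K_def)
    finally have 1: "q \<le> K * p + C" using K by simp
    have "p \<le> real (6 * K2 * N) * q + C"
      unfolding p_def q_def C_def using lower[OF h] by (metis of_nat_le_iff of_nat_mult of_nat_add)
    also have "\<dots> \<le> K * q + C" using pos by (intro add_right_mono mult_right_mono) (simp_all add: K_def)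
    also have "\<dots> \<le> K * q + K * C" using K mult_right_mono[of 1 K C] by simp
    finally have "p / K \<le> q + C" using K by (simp add: field_simps)
    then have 2: "1 / K * p - C \<le> q" by simp
    from 1 2 show ?thesis unfolding pq by simp
  qed
  then show ?thesis
    unfolding quasi_isometric_embedding_def using F_sub_T K(1)
    by (intro conjI exI[of _ K] exI[of _ C]) auto
qed

theorem corollary5p2:
  shows "quasi_isometric_embedding
           (carrier thompson_F) (word_metric thompson_F {x0, x1})
           (carrier thompson_T) (word_metric thompson_T {x0, x1, c1}) (\<lambda>w. w) \<and>
         (\<forall>A B. finite_generating_set thompson_F A \<and> finite_generating_set thompson_T B \<longrightarrow>
           quasi_isometric_embedding
             (carrier thompson_F) (word_metric thompson_F A)
             (carrier thompson_T) (word_metric thompson_T B) (\<lambda>w. w))"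
proof (intro conjI allI impI)
  have T: "{x0, x1, c1} \<subseteq> carrier thompson_T"
    using x0_in_T x1_in_T c1_in_T by (simp add: carrier_T)
  have "carrier thompson_F = generate thompson_T {x0, x1}"
    using T.generate_consistent[OF generators_F subgroup_F_T] F_generated thompson_F_eq by metis
  also have "\<dots> \<subseteq> generate thompson_T {x0, x1, c1}"
    by (rule T.mono_generate) auto
  finally show "quasi_isometric_embedding
           (carrier thompson_F) (word_metric thompson_F {x0, x1})
           (carrier thompson_T) (word_metric thompson_T {x0, x1, c1}) (\<lambda>w. w)"
    using generators_F F_generated T by (intro F_in_T_quasi_isometric) auto
next
  fix A B
  assume "finite_generating_set thompson_F A \<and> finite_generating_set thompson_T B"
  then show "quasi_isometric_embedding
             (carrier thompson_F) (word_metric thompson_F A)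
             (carrier thompson_T) (word_metric thompson_T B) (\<lambda>w. w)"
    unfolding finite_generating_set_def using F_sub_T
    by (intro F_in_T_quasi_isometric) auto
qed

end
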